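(* Let $m\ge 1$ and let $L$ be an $m$-component (classical or virtual) long link. Let $G$ be a based Gauss diagram of $L$. Then the polynomials $\nabla_{asc}(G)=\sum_{n\ge 0}A_{n,m}(G)z^n$ and $\nabla_{des}(G)=\sum_{n\ge 0}D_{n,m}(G)z^n$ do not depend on the choice of the Gauss diagram $G$ representing $L$; that is, they are invariants of long links: if two based Gauss diagrams with $m$ circles are related by a finite sequence of Reidemeister moves $\Omega_1,\Omega_2,\Omega_3$ applied away from the base point, then they have the same $\nabla_{asc}$ and the same $\nabla_{des}$.
   Context: **Gauss diagrams.** A Gauss diagram is a finite collection of oriented circles together with finitely many arrows, each with a sign $\pm1$, connecting pairs of points on the circles (all endpoints distinct), up to orientation-preserving diffeomorphisms of the circles. The Gauss diagram of an oriented link diagram has one circle per component and one arrow per (classical) crossing, pointing from the preimage on the overpass to the preimage on the underpass, with sign the writhe of the crossing; virtual crossings are disregarded. A Gauss diagram is based if a base point, different from all arrow endpoints, is marked on one circle. **Long links and Reidemeister moves.** A (virtual) long link is an equivalence class of based Gauss diagrams under the following moves and their inverses, applied away from the base point. $\Omega_1$: insert an arrow of any sign and direction whose two endpoints are adjacent on a circle. $\Omega_2$: insert two arrows of opposite signs whose tails are adjacent on one arc and whose heads are adjacent on another arc (in either order). $\Omega_3$: the move induced on Gauss diagrams by the oriented third Reidemeister move; given $\Omega_1$ and $\Omega_2$ it suffices to take the following one: there are three short segments $a,b,c$ of circles carrying positive arrows $a\to b$, $a\to c$, $b\to c$ and no other endpoints, where along the orientation $a$ meets first the arrow to $b$ and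 then the arrow to $c$, $b$ meets first the arrow from $a$ and then the arrow to $c$, $c$ meets first the arrow from $a$ and then the arrow from $b$; the move reverses the order of the two endpoints on each of the three segments. A long link is classical if it is represented by the based Gauss diagram of a classical link diagram. **Arrow diagrams and pairing.** An arrow diagram is defined like a based Gauss diagram but without signs on arrows; all arrow diagrams are assumed based and connected as graphs (circles together with arrows). For an arrow diagram $A$ and a based Gauss diagram $G$, both with $m$ circles, a homomorphism $\phi:A\to G$ consists of orientation-preserving homeomorphisms of the circles of $A$ onto the circles of $G$ (bijectively on circles), taking base point to base point and inducing an injection of the arrows of $A$ into the arrows of $G$ (respecting directions); it is determined by its set $S(\phi)$ of image arrows (called a state). Put $\operatorname{sign}(\phi)=\prod_{\alpha\in S(\phi)}\operatorname{sign}(\alpha)$ and $\langle A,G\rangle=\sum_{\phi:A\to G}\operatorname{sign}(\phi)$. **Surfaces, ascending and descending diagrams.** For an arrow diagram $A$, the oriented surface $\Sigma(A)$ is obtained by filling each circle with an oriented disk and attaching to the boundaries of the disks a ribbon along each arrow. The number of boundary components of $A$ is that of $\Sigma(A)$. Combinatorially, the boundary of $\Sigma(A)$ is traced by following circles along their orientation and, each time an endpoint of an arrow is reached, jumping to the other endpoint of that arrow and continuing along the orientation. If $A$ has one boundary component, start the tracing at the base point; each arrow is approached twice, once at its head and once at its tail. $A$ is ascending (respectively descending) if each arrow is approached for the first time at its head (respectively at its tail). Let $\mathcal A_{n,m}$ (respectively $\mathcal D_{n,m}$) be the set of all ascending (respectively descending) arrow diagrams with $n$ arrows, $m$ circles and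 one boundary component. For a based Gauss diagram $G$ with $m$ circles put $$A_{n,m}(G)=\sum_{A\in\mathcal A_{n,m}}\langle A,G\rangle,\qquad D_{n,m}(G)=\sum_{A\in\mathcal D_{n,m}}\langle A,G\rangle .$$ *)

theory Defs
  imports
    "HOL-Computational_Algebra.Polynomial"
    "HOL-Combinatorics.Combinatorics"
    "HOL-Library.FuncSet"
    "HOL-Library.Sublist"
begin

section \<open>Based diagrams\<close>

text \<open>
  Diagrams are encoded by words.  A diagram is a list of circles, each circle being the list of the
  arrow endpoints met along its orientation.  Circle number 0 is the based one, and its word is read
  from the base point.  The words of the other circles are cyclic words, cut at an arbitrary place
  other than an endpoint.  The choice of the cut, the numbering of the other circles and the names
  of the arrows are immaterial; they are divided out by the isomorphisms below.
\<close>

datatype 'a endpoint = Tail (arrow_of: 'a) | Head (arrow_of: 'a)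

type_synonym diagram = "nat endpoint list list"

fun opposite :: "'a endpoint \<Rightarrow> 'a endpoint" where
  "opposite (Tail a) = Head a"
| "opposite (Head a) = Tail a"

definition endpoints :: "diagram \<Rightarrow> nat endpoint set" where
  "endpoints C = set (concat C)"

definition arrows :: "diagram \<Rightarrow> nat set" where
  "arrows C = arrow_of ` endpoints C"

definition based_diagram :: "nat \<Rightarrow> diagram \<Rightarrow> bool" where
  "based_diagram m C \<longleftrightarrow>
     C \<noteq> [] \<and> length C = m \<and> distinct (concat C) \<and>
     (\<forall>a. Tail a \<in> endpoints C \<longleftrightarrow> Head a \<in> endpoints C)"

datatype gauss_diagram = Gauss (circles: diagram) (sign: "nat \<Rightarrow> int")

text \<open>The values of \<open>sign\<close> outside the arrows of the diagram are irrelevant.\<close>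

definition based_gauss_diagram :: "nat \<Rightarrow> gauss_diagram \<Rightarrow> bool" where
  "based_gauss_diagram m G \<longleftrightarrow>
     based_diagram m (circles G) \<and> (\<forall>a\<in>arrows (circles G). sign G a \<in> {1, -1})"

definition connected_diagram :: "diagram \<Rightarrow> bool" where
  "connected_diagram C \<longleftrightarrow>
     (\<forall>i<length C. \<forall>j<length C.
        (i, j) \<in> {(i, j). i < length C \<and> j < length C \<and>
                          (\<exists>p\<in>set (C ! i). opposite p \<in> set (C ! j))}\<^sup>*)"

definition arrow_diagram :: "nat \<Rightarrow> diagram \<Rightarrow> bool" where
  "arrow_diagram m A \<longleftrightarrow> based_diagram m A \<and> connected_diagram A"

section \<open>Homomorphisms and the pairing\<close>

text \<open>
  A homomorphism, taken up to isotopy, is given by a bijection \<open>s\<close> of the circles fixing the based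
  one and an injection \<open>f\<close> of the arrows.  These data come from orientation-preserving
  homeomorphisms of the circles if and only if the endpoints of the image arrows on circle \<open>s i\<close> are
  exactly the images of the endpoints on circle \<open>i\<close>, in the same cyclic order (linear order starting
  from the base point if \<open>i = 0\<close>).  The maps \<open>s\<close> and \<open>f\<close> are normalised outside their domains, so
  that distinct pairs are distinct homomorphisms.
\<close>

definition restrict_circle :: "nat set \<Rightarrow> nat endpoint list \<Rightarrow> nat endpoint list" where
  "restrict_circle S c = filter (\<lambda>p. arrow_of p \<in> S) c"

definition homs :: "diagram \<Rightarrow> diagram \<Rightarrow> ((nat \<Rightarrow> nat) \<times> (nat \<Rightarrow> nat)) set" where
  "homs A C = {(s, f).
     length A = length C \<and>
     s permutes {..<length A} \<and> s 0 = 0 \<and>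
     f \<in> arrows A \<rightarrow>\<^sub>E arrows C \<and> inj_on f (arrows A) \<and>
     restrict_circle (f ` arrows A) (C ! 0) = map (map_endpoint f) (A ! 0) \<and>
     (\<forall>i<length A. \<exists>k. rotate k (restrict_circle (f ` arrows A) (C ! s i))
                          = map (map_endpoint f) (A ! i))}"

definition hom_sign :: "diagram \<Rightarrow> gauss_diagram \<Rightarrow> (nat \<Rightarrow> nat) \<times> (nat \<Rightarrow> nat) \<Rightarrow> int" where
  "hom_sign A G \<phi> = (\<Prod>a \<in> snd \<phi> ` arrows A. sign G a)"

definition pairing :: "diagram \<Rightarrow> gauss_diagram \<Rightarrow> int" where
  "pairing A G = (\<Sum>\<phi>\<in>homs A (circles G). hom_sign A G \<phi>)"

definition diagram_iso :: "diagram \<Rightarrow> diagram \<Rightarrow> bool" where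
  "diagram_iso A B \<longleftrightarrow> (\<exists>(s, f)\<in>homs A B. f ` arrows A = arrows B)"

definition gauss_iso :: "gauss_diagram \<Rightarrow> gauss_diagram \<Rightarrow> bool" where
  "gauss_iso G H \<longleftrightarrow>
     (\<exists>(s, f)\<in>homs (circles G) (circles H).
        f ` arrows (circles G) = arrows (circles H) \<and>
        (\<forall>a\<in>arrows (circles G). sign H (f a) = sign G a))"

section \<open>Boundary of the surface, ascending and descending diagrams\<close>

definition next_endpoint :: "diagram \<Rightarrow> nat endpoint \<Rightarrow> nat endpoint" where
  "next_endpoint C p =
     (THE q. \<exists>c\<in>set C. \<exists>k<length c. p = c ! k \<and> q = c ! (Suc k mod length c))"

text \<open>
  If the tracing of the boundary has just approached the endpoint \<open>p\<close>, then \<open>trace_step C p\<close> is the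
  endpoint approached next.
\<close>

definition trace_step :: "diagram \<Rightarrow> nat endpoint \<Rightarrow> nat endpoint" where
  "trace_step C p = next_endpoint C (opposite p)"

text \<open>
  A boundary component of the surface approaches either no endpoint at all, and then it is the
  boundary of a disk without ribbons, or the endpoints of one orbit of \<open>trace_step\<close>.
\<close>

definition boundary_components :: "diagram \<Rightarrow> nat" where
  "boundary_components C =
     card (orbit (trace_step C) ` endpoints C) + card {i. i < length C \<and> C ! i = []}"

text \<open>
  The endpoint approached after \<open>k\<close> steps when tracing from the base point.  This is meaningless if
  there is no endpoint on the based circle, but then a connected diagram has no arrows.
\<close>

definition approached :: "diagram \<Rightarrow> nat \<Rightarrow> nat endpoint" where
  "approached C k = (trace_step C ^^ k) (hd (C ! 0))"

definition ascending :: "diagram \<Rightarrow> bool" where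
  "ascending A \<longleftrightarrow>
     (\<forall>a\<in>arrows A. \<exists>k. approached A k = Head a \<and> (\<forall>j<k. approached A j \<noteq> Tail a))"

definition descending :: "diagram \<Rightarrow> bool" where
  "descending A \<longleftrightarrow>
     (\<forall>a\<in>arrows A. \<exists>k. approached A k = Tail a \<and> (\<forall>j<k. approached A j \<noteq> Head a))"

definition one_component_diagrams :: "nat \<Rightarrow> nat \<Rightarrow> diagram set" where
  "one_component_diagrams n m =
     {A. arrow_diagram m A \<and> card (arrows A) = n \<and> boundary_components A = 1}"

definition iso_rel :: "nat \<Rightarrow> (diagram \<times> diagram) set" where
  "iso_rel m = {(A, B). arrow_diagram m A \<and> arrow_diagram m B \<and> diagram_iso A B}"

definition ascending_classes :: "nat \<Rightarrow> nat \<Rightarrow> diagram set set" where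
  "ascending_classes n m = {A \<in> one_component_diagrams n m. ascending A} // iso_rel m"

definition descending_classes :: "nat \<Rightarrow> nat \<Rightarrow> diagram set set" where
  "descending_classes n m = {A \<in> one_component_diagrams n m. descending A} // iso_rel m"

text \<open>The pairing does not depend on the representative of the isomorphism class.\<close>

definition class_pairing :: "diagram set \<Rightarrow> gauss_diagram \<Rightarrow> int" where
  "class_pairing X G = pairing (SOME A. A \<in> X) G"

definition asc_coeff :: "nat \<Rightarrow> nat \<Rightarrow> gauss_diagram \<Rightarrow> int" where
  "asc_coeff n m G = (\<Sum>X\<in>ascending_classes n m. class_pairing X G)"

definition desc_coeff :: "nat \<Rightarrow> nat \<Rightarrow> gauss_diagram \<Rightarrow> int" where
  "desc_coeff n m G = (\<Sum>X\<in>descending_classes n m. class_pairing X G)"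

text \<open>
  The sums stop at the number of arrows of \<open>G\<close> because all later coefficients vanish; see
  \<open>coeff_nabla_asc\<close> and \<open>coeff_nabla_des\<close> below.
\<close>

definition nabla_asc :: "gauss_diagram \<Rightarrow> int poly" where
  "nabla_asc G =
     (\<Sum>n\<le>card (arrows (circles G)). monom (asc_coeff n (length (circles G)) G) n)"

definition nabla_des :: "gauss_diagram \<Rightarrow> int poly" where
  "nabla_des G =
     (\<Sum>n\<le>card (arrows (circles G)). monom (desc_coeff n (length (circles G)) G) n)"

lemma finite_arrows: "finite (arrows C)"
  by (simp add: arrows_def endpoints_def)

lemma pairing_eq_0:
  assumes "card (arrows (circles G)) < card (arrows A)"
  shows "pairing A G = 0"
proof -
  have "homs A (circles G) = {}"
  proof (rule ccontr)
    assume "homs A (circles G) \<noteq> {}"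
    then obtain f where "f \<in> arrows A \<rightarrow>\<^sub>E arrows (circles G)" "inj_on f (arrows A)"
      by (auto simp: homs_def)
    then have "card (arrows A) \<le> card (arrows (circles G))"
      by (intro card_inj_on_le[of f]) (auto simp: finite_arrows)
    then show False using assms by simp
  qed
  then show ?thesis by (simp add: pairing_def)
qed

lemma diagram_iso_refl:
  assumes "arrow_diagram m A"
  shows "diagram_iso A A"
proof -
  let ?f = "restrict id (arrows A)"
  have img: "?f ` arrows A = arrows A" by auto
  have eq: "map (map_endpoint ?f) c = c" and res: "restrict_circle (arrows A) c = c"
    if "c \<in> set A" for c
  proof -
    have *: "arrow_of p \<in> arrows A" if "p \<in> set c" for p
      using that \<open>c \<in> set A\<close> by (auto simp: arrows_def endpoints_def)
    show "map (map_endpoint ?f) c = c"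
    proof (rule map_idI)
      fix p assume "p \<in> set c"
      from *[OF this] show "map_endpoint ?f p = p" by (cases p) auto
    qed
    show "restrict_circle (arrows A) c = c"
      using * by (simp add: restrict_circle_def)
  qed
  have "A \<noteq> []" using assms by (simp add: arrow_diagram_def based_diagram_def)
  then have "(id, ?f) \<in> homs A A"
    using eq res
    by (auto simp: homs_def img permutes_id inj_on_def intro!: exI[of _ 0])
  then show ?thesis unfolding diagram_iso_def using img by blast
qed

lemma diagram_iso_card:
  assumes "diagram_iso A B"
  shows "card (arrows B) = card (arrows A)"
  using assms by (auto simp: diagram_iso_def homs_def dest: card_image)

lemma class_pairing_eq_0:
  assumes X: "X \<in> Y // iso_rel m" and Y: "Y \<subseteq> one_component_diagrams n m"
    and n: "card (arrows (circles G)) < n"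
  shows "class_pairing X G = 0"
proof -
  obtain A where A: "A \<in> Y" "X = iso_rel m `` {A}" using X by (rule quotientE)
  then have A': "arrow_diagram m A" "card (arrows A) = n"
    using Y by (auto simp: one_component_diagrams_def)
  then have "A \<in> X" using A diagram_iso_refl by (auto simp: iso_rel_def)
  then have "(SOME A. A \<in> X) \<in> X" by (rule someI)
  then have "card (arrows (SOME A. A \<in> X)) = n"
    using A A' diagram_iso_card by (auto simp: iso_rel_def)
  then show ?thesis using n by (simp add: class_pairing_def pairing_eq_0)
qed

lemma coeff_nabla_asc: "coeff (nabla_asc G) n = asc_coeff n (length (circles G)) G"
proof (cases "n \<le> card (arrows (circles G))")
  case False
  then have "asc_coeff n (length (circles G)) G = 0"
    unfolding asc_coeff_def ascending_classes_def
    by (intro sum.neutral ballI class_pairing_eq_0) auto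
  then show ?thesis using False by (simp add: nabla_asc_def coeff_sum)
qed (simp add: nabla_asc_def coeff_sum)

lemma coeff_nabla_des: "coeff (nabla_des G) n = desc_coeff n (length (circles G)) G"
proof (cases "n \<le> card (arrows (circles G))")
  case False
  then have "desc_coeff n (length (circles G)) G = 0"
    unfolding desc_coeff_def descending_classes_def
    by (intro sum.neutral ballI class_pairing_eq_0) auto
  then show ?thesis using False by (simp add: nabla_des_def coeff_sum)
qed (simp add: nabla_des_def coeff_sum)

section \<open>Reidemeister moves and long links\<close>

text \<open>
  No endpoint and no base point lies on the arc from \<open>p\<close> to \<open>q\<close>.  Adjacency across the cut of an
  unbased circle is not included: since the moves are combined with isomorphisms, the cut can be
  moved out of the way first.
\<close>

definition adjacent :: "diagram \<Rightarrow> nat endpoint \<Rightarrow> nat endpoint \<Rightarrow> bool" where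
  "adjacent C p q \<longleftrightarrow> (\<exists>c\<in>set C. sublist [p, q] c)"

definition delete_arrows :: "nat set \<Rightarrow> gauss_diagram \<Rightarrow> gauss_diagram" where
  "delete_arrows S G =
     Gauss (map (restrict_circle (- S)) (circles G)) (sign G)"

text \<open>In the first two moves, the arrows are inserted when passing from \<open>G\<close> to \<open>H\<close>.\<close>

definition omega1 :: "gauss_diagram \<Rightarrow> gauss_diagram \<Rightarrow> bool" where
  "omega1 G H \<longleftrightarrow>
     (\<exists>a\<in>arrows (circles H).
        (adjacent (circles H) (Tail a) (Head a) \<or> adjacent (circles H) (Head a) (Tail a)) \<and>
        G = delete_arrows {a} H)"

definition omega2 :: "gauss_diagram \<Rightarrow> gauss_diagram \<Rightarrow> bool" where
  "omega2 G H \<longleftrightarrow>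
     (\<exists>a\<in>arrows (circles H). \<exists>b\<in>arrows (circles H).
        a \<noteq> b \<and> sign H b = - sign H a \<and>
        adjacent (circles H) (Tail a) (Tail b) \<and>
        (adjacent (circles H) (Head a) (Head b) \<or> adjacent (circles H) (Head b) (Head a)) \<and>
        G = delete_arrows {a, b} H)"

text \<open>
  The arrows \<open>x\<close>, \<open>y\<close>, \<open>z\<close> go from the first segment to the second, from the first to the third, and
  from the second to the third.
\<close>

definition omega3 :: "gauss_diagram \<Rightarrow> gauss_diagram \<Rightarrow> bool" where
  "omega3 G H \<longleftrightarrow>
     (\<exists>x y z. distinct [x, y, z] \<and> {x, y, z} \<subseteq> arrows (circles G) \<and>
        sign G x = 1 \<and> sign G y = 1 \<and> sign G z = 1 \<and>
        adjacent (circles G) (Tail x) (Tail y) \<and>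
        adjacent (circles G) (Head x) (Tail z) \<and>
        adjacent (circles G) (Head y) (Head z) \<and>
        H = Gauss
              (map (map (transpose (Tail x) (Tail y) \<circ> transpose (Head x) (Tail z)
                         \<circ> transpose (Head y) (Head z))) (circles G))
              (sign G))"

definition reidemeister_step :: "nat \<Rightarrow> gauss_diagram \<Rightarrow> gauss_diagram \<Rightarrow> bool" where
  "reidemeister_step m G H \<longleftrightarrow>
     based_gauss_diagram m G \<and> based_gauss_diagram m H \<and>
     (gauss_iso G H \<or> omega1 G H \<or> omega2 G H \<or> omega3 G H)"

definition long_link_rel :: "nat \<Rightarrow> (gauss_diagram \<times> gauss_diagram) set" where
  "long_link_rel m =
     {(G, H). based_gauss_diagram m G \<and> based_gauss_diagram m H \<and>
              equivclp (reidemeister_step m) G H}"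

definition long_links :: "nat \<Rightarrow> gauss_diagram set set" where
  "long_links m = {G. based_gauss_diagram m G} // long_link_rel m"

end

theory Submission
  imports Defs
begin

text \<open>
  Isomorphisms between connected based diagrams are unique, so a coefficient of the polynomial is the
  sum, over the sets \<open>S\<close> of arrows of \<open>G\<close> spanning a one-component ascending (descending)
  subdiagram, of the product of their signs.  The moves are compared on such states.
  An \<open>\<Omega>\<^sub>1\<close>-arrow in \<open>S\<close> splits off a boundary component.  If \<open>S\<close> contains both arrows of an
  \<open>\<Omega>\<^sub>2\<close>-pair, then either a component splits off, or the two arrows are first approached at opposite
  ends; states with just one of them cancel in pairs.
  For \<open>\<Omega>\<^sub>3\<close>, fix the part of \<open>S\<close> outside the triangle.  Tracing the boundary, one enters the triangle
  three times, and what matters is only where each passage leaves it and in which order the three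
  passages occur.  For zero, one or three triangle arrows in \<open>S\<close> these data are the same before and
  after the move.  For two arrows, the states of either side with the same exits impose conditions on the
  order of the passages that together describe the same set of orders.
\<close>

section \<open>Cyclic words and first returns\<close>

text \<open>A state is a diagram of its own with fewer endpoints, so traces of different states live
  on different sets. The device used throughout is that erasing points from a cycle of a permutation
  turns the permutation into its first return map. It is applied twice: a state becomes a
  permutation of all endpoints that walks past the arrows outside it, and in the third move the
  triangle is collapsed by erasing the second point of each segment. In the other direction, a cycle
  of the first return map lifts to a full cycle only if no cycle lies entirely among the erased
  points; such a hidden cycle would be an extra boundary component. Listing the boundary as a word
  that starts at the base point turns ascending and descending into conditions on a linear order.
  Since the moves avoid the base point, a point and its immediate successor compare alike with every
  other point. The successor map is polymorphic because it is applied to endpoints, to endpoints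
  with markers, and to a boundary word regarded as a single circle.\<close>

definition cnext :: "'a list list \<Rightarrow> 'a \<Rightarrow> 'a" where
  "cnext Cs p = (THE q. \<exists>c\<in>set Cs. \<exists>k<length c. p = c ! k \<and> q = c ! (Suc k mod length c))"

lemma next_endpoint_eq_cnext: "next_endpoint C = cnext C"
  by (simp add: fun_eq_iff next_endpoint_def cnext_def)

lemma distinct_concatD:
  assumes "distinct (concat Cs)" "c \<in> set Cs" "d \<in> set Cs" "x \<in> set c" "x \<in> set d"
  shows "c = d"
  using assms unfolding distinct_concat_iff by blast

lemma distinct_concat_mem: "distinct (concat Cs) \<Longrightarrow> c \<in> set Cs \<Longrightarrow> distinct c"
  by (simp add: distinct_concat_iff)

lemma cnext_nth:
  assumes "distinct (concat Cs)" "c \<in> set Cs" "k < length c"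
  shows "cnext Cs (c ! k) = c ! (Suc k mod length c)"
  unfolding cnext_def
proof (rule the_equality)
  fix q assume "\<exists>d\<in>set Cs. \<exists>l<length d. c ! k = d ! l \<and> q = d ! (Suc l mod length d)"
  then obtain d l where d: "d \<in> set Cs" "l < length d" "c ! k = d ! l" "q = d ! (Suc l mod length d)"
    by blast
  then have "d = c"
    using assms by (metis distinct_concatD nth_mem)
  with d assms show "q = c ! (Suc k mod length c)"
    using distinct_concat_mem nth_eq_iff_index_eq by blast
qed (use assms in blast)

text \<open>Reading the circle from just after \<open>x\<close> puts its successor first; the
  trailing \<open>[x]\<close> covers the circle that consists of \<open>x\<close> alone.\<close>

lemma cnext_split:
  assumes "distinct (concat Cs)" "u @ x # v \<in> set Cs"
  shows "cnext Cs x = hd (v @ u @ [x])"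
proof -
  have "cnext Cs x = (u @ x # v) ! (Suc (length u) mod length (u @ x # v))"
    using cnext_nth[OF assms, of "length u"] by simp
  also have "\<dots> = hd (v @ u @ [x])"
    by (cases v; cases u) (auto simp: nth_append)
  finally show ?thesis .
qed

lemma cnext_mem:
  assumes "distinct (concat Cs)" "c \<in> set Cs" "x \<in> set c"
  shows "cnext Cs x \<in> set c"
  using assms cnext_nth by (metis in_set_conv_nth length_pos_if_in_set mod_less_divisor nth_mem)

lemma cnext_closed: "distinct (concat Cs) \<Longrightarrow> x \<in> set (concat Cs) \<Longrightarrow> cnext Cs x \<in> set (concat Cs)"
  using cnext_mem by fastforce

lemma inj_on_cnext:
  assumes "distinct (concat Cs)"
  shows "inj_on (cnext Cs) (set (concat Cs))"
proof (rule inj_onI)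
  fix x y assume "x \<in> set (concat Cs)" "y \<in> set (concat Cs)" and eq: "cnext Cs x = cnext Cs y"
  then obtain c d where c: "c \<in> set Cs" "x \<in> set c" and d: "d \<in> set Cs" "y \<in> set d" by auto
  have "c = d"
    using cnext_mem[OF assms c] cnext_mem[OF assms d] eq distinct_concatD[OF assms] c d by metis
  from c d this obtain k l where kl: "k < length c" "x = c ! k" "l < length c" "y = c ! l"
    by (metis in_set_conv_nth)
  have "Suc k mod length c = Suc l mod length c"
    using eq kl c cnext_nth[OF assms c(1)] distinct_concat_mem[OF assms c(1)]
    by (metis length_pos_if_in_set mod_less_divisor nth_eq_iff_index_eq)
  then have "k = l"
    using kl by (auto simp: mod_Suc split: if_splits)
  then show "x = y" using kl by simp
qed

lemma cnext_map:
  assumes d: "distinct (concat Cs)" and g: "inj_on g (set (concat Cs))" and x: "x \<in> set (concat Cs)"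
  shows "cnext (map (map g) Cs) (g x) = g (cnext Cs x)"
proof -
  from x obtain c where c: "c \<in> set Cs" "x \<in> set c" by auto
  then obtain k where k: "k < length c" "x = c ! k" by (metis in_set_conv_nth)
  have d': "distinct (concat (map (map g) Cs))"
    using d g by (simp add: map_concat[symmetric] distinct_map)
  have "cnext (map (map g) Cs) (map g c ! k) = map g c ! (Suc k mod length (map g c))"
    using c k by (intro cnext_nth[OF d']) auto
  also have "\<dots> = g (c ! (Suc k mod length c))"
    using k by (metis length_map length_pos_if_in_set mod_less_divisor nth_map nth_mem)
  finally show ?thesis using cnext_nth[OF d c(1) k(1)] k by simp
qed

text \<open>\<open>ret P f p q\<close>: the first point satisfying \<open>P\<close> on the forward \<open>f\<close>-orbit of \<open>p\<close>, not counting \<open>p\<close>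
  itself, is \<open>q\<close>.\<close>

inductive ret :: "('a \<Rightarrow> bool) \<Rightarrow> ('a \<Rightarrow> 'a) \<Rightarrow> 'a \<Rightarrow> 'a \<Rightarrow> bool" for P f where
  now: "P (f p) \<Longrightarrow> ret P f p (f p)"
| later: "\<not> P (f p) \<Longrightarrow> ret P f (f p) q \<Longrightarrow> ret P f p q"

text \<open>As an equation this lets the simplifier follow a passage step by step, which is how the
  sixteen triangle states are evaluated.\<close>

lemma ret_unfold: "ret P f p q \<longleftrightarrow> (if P (f p) then q = f p else ret P f (f p) q)"
  by (subst ret.simps) auto

lemma ret_unique: "ret P f p q \<Longrightarrow> ret P f p r \<Longrightarrow> q = r"
  by (induction rule: ret.induct) (metis ret_unfold)+

lemma ret_mem:
  assumes "ret P f p q" "p \<in> X" "\<And>x. x \<in> X \<Longrightarrow> f x \<in> X"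
  shows "q \<in> X"
  using assms by (induction rule: ret.induct) auto

lemma ret_cong:
  assumes "ret P f p q" "p \<in> X" "\<And>x. x \<in> X \<Longrightarrow> f x \<in> X" "\<And>x. x \<in> X \<Longrightarrow> f x = g x"
  shows "ret P g p q"
  using assms by (induction rule: ret.induct) (metis ret_unfold)+

text \<open>One full turn from \<open>x\<close> reads \<open>v\<close>, then \<open>u\<close>, then
  \<open>x\<close> again, so the first letter of this word satisfying \<open>P\<close> is the first
  return. The induction is on the number of letters skipped and moves the cut by one letter each
  time.\<close>

lemma ret_cnext:
  assumes "distinct (concat Cs)" "u @ x # v \<in> set Cs" "\<exists>y\<in>set (u @ x # v). P y"
  shows "ret P (cnext Cs) x (hd (filter P (v @ u @ [x])))"
  using assms
proof (induction "length (takeWhile (\<lambda>y. \<not> P y) (v @ u @ [x]))" arbitrary: u x v rule: less_induct)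
  case less
  have nx: "cnext Cs x = hd (v @ u @ [x])"
    using cnext_split less.prems by metis
  obtain y r where r: "v @ u @ [x] = y # r" by (cases "v @ u @ [x]") auto
  show ?case
  proof (cases "P y")
    case True
    then show ?thesis using nx r by (simp add: ret_unfold)
  next
    case False
    \<comment> \<open>The same circle is cut at the next letter \<open>y\<close>; if
      \<open>v\<close> is empty, \<open>y\<close> comes from the front of \<open>u\<close>.\<close>
    have "\<exists>u' v'. u' @ y # v' = u @ x # v \<and> v' @ u' @ [y] = r @ [y]"
    proof (cases v)
      case Nil
      then show ?thesis
      proof (cases u)
        case Nil
        with \<open>v = []\<close> r less.prems False show ?thesis by auto
      next
        case (Cons z u'')
        with \<open>v = []\<close> r show ?thesis by (intro exI[of _ "[]"] exI[of _ "u'' @ [x]"]) auto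
      qed
    next
      case (Cons z v'')
      with r show ?thesis by (intro exI[of _ "u @ [x]"] exI[of _ v'']) auto
    qed
    then obtain u' v' where uv: "u' @ y # v' = u @ x # v" "v' @ u' @ [y] = r @ [y]" by blast
    have ex: "\<exists>z\<in>set r. P z"
      using less.prems(3) r False by (metis Un_iff set_append set_ConsD list.set_intros(1) append_Cons append_assoc rotate1.simps(2) Un_commute)
    have "ret P (cnext Cs) y (hd (filter P (v' @ u' @ [y])))"
    proof (rule less.hyps)
      have "takeWhile (\<lambda>y. \<not> P y) (r @ [y]) = takeWhile (\<lambda>y. \<not> P y) r"
        using ex by (metis takeWhile_append1)
      then show "length (takeWhile (\<lambda>y. \<not> P y) (v' @ u' @ [y])) < length (takeWhile (\<lambda>y. \<not> P y) (v @ u @ [x]))"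
        using False unfolding uv r by simp
    qed (use less.prems uv in auto)
    also have "filter P (v' @ u' @ [y]) = filter P (v @ u @ [x])"
      using False unfolding uv r by simp
    finally show ?thesis using False nx r by (subst ret_unfold) simp
  qed
qed

lemma distinct_concat_filter: "distinct (concat Cs) \<Longrightarrow> distinct (concat (map (filter P) Cs))"
  by (metis distinct_filter filter_concat)

text \<open>Walking forward from \<open>x\<close> skips exactly the letters that
  \<open>filter P\<close> deletes. This identity between erasing points and first returns serves
  both the passage to states and the collapse of the triangle.\<close>

lemma ret_cnext_filter:
  assumes "distinct (concat Cs)" "x \<in> set (concat Cs)" "P x"
  shows "ret P (cnext Cs) x (cnext (map (filter P) Cs) x)"
proof -
  from assms obtain c where c: "c \<in> set Cs" "x \<in> set c" by auto
  then obtain u v where uv: "c = u @ x # v" by (meson split_list)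
  have "filter P u @ x # filter P v \<in> set (map (filter P) Cs)"
    using imageI[OF c(1), of "filter P"] uv assms by simp
  from cnext_split[OF distinct_concat_filter[OF assms(1)] this]
  have "cnext (map (filter P) Cs) x = hd (filter P (v @ u @ [x]))"
    using assms by simp
  then show ?thesis
    using ret_cnext[OF assms(1), of u x v P] c uv assms by auto
qed

text \<open>A cycle of \<open>T\<close> with a chosen start. Being a list, it carries the linear
  order in which the points are met; the last letter leads back to the head because
  \<open>cnext\<close> wraps around.\<close>

definition cyclic_word :: "('a \<Rightarrow> 'a) \<Rightarrow> 'a list \<Rightarrow> bool" where
  "cyclic_word T w \<longleftrightarrow> w \<noteq> [] \<and> distinct w \<and> (\<forall>p\<in>set w. T p = cnext [w] p)"

lemma cyclic_word_nth:
  "cyclic_word T w \<longleftrightarrow> w \<noteq> [] \<and> distinct w \<and> (\<forall>k<length w. T (w ! k) = w ! (Suc k mod length w))"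
proof -
  have "T (w ! k) = cnext [w] (w ! k) \<longleftrightarrow> T (w ! k) = w ! (Suc k mod length w)"
    if "distinct w" "k < length w" for k
    using cnext_nth[of "[w]" w k] that by simp
  then show ?thesis by (auto simp: cyclic_word_def all_set_conv_all_nth)
qed

lemma cyclic_word_closed: "cyclic_word T w \<Longrightarrow> p \<in> set w \<Longrightarrow> T p \<in> set w"
  unfolding cyclic_word_def using cnext_mem[of "[w]" w p] by simp

lemma cyclic_word_funpow:
  assumes "cyclic_word T w"
  shows "(T ^^ k) (hd w) = w ! (k mod length w)"
proof (induction k)
  case 0
  then show ?case using assms by (simp add: cyclic_word_def hd_conv_nth)
next
  case (Suc k)
  have "k mod length w < length w" using assms by (simp add: cyclic_word_def)
  then show ?case using Suc assms by (auto simp: cyclic_word_nth mod_Suc_eq)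
qed

lemma cyclic_word_set: "cyclic_word T w \<Longrightarrow> set w = range (\<lambda>k. (T ^^ k) (hd w))"
proof (intro equalityI subsetI)
  fix p assume w: "cyclic_word T w" and "p \<in> set w"
  then obtain k where "k < length w" "p = w ! k" by (metis in_set_conv_nth)
  then show "p \<in> range (\<lambda>k. (T ^^ k) (hd w))"
    using cyclic_word_funpow[OF w, of k] by (intro image_eqI[of _ _ k]) auto
next
  fix p assume w: "cyclic_word T w" and "p \<in> range (\<lambda>k. (T ^^ k) (hd w))"
  then show "p \<in> set w"
    using cyclic_word_funpow[OF w] by (auto simp: cyclic_word_def)
qed

text \<open>Both words list the orbit of the common head under the same map, and distinctness fixes
  the length.\<close>

lemma cyclic_word_unique:
  assumes "cyclic_word T w" "cyclic_word T v" "hd w = hd v"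
  shows "w = v"
proof (rule nth_equalityI)
  have "set w = set v" using assms cyclic_word_set by metis
  then show len: "length w = length v"
    using assms by (metis cyclic_word_def distinct_card)
  fix i assume "i < length w"
  then show "w ! i = v ! i"
    using cyclic_word_funpow[OF assms(1), of i] cyclic_word_funpow[OF assms(2), of i] assms(3) len by simp
qed

text \<open>\<open>T\<close> acts transitively on its cycle, so an invariant set that meets the
  cycle swallows it. Contraposed, a proper invariant set reveals a second boundary
  component.\<close>

lemma cyclic_word_subset:
  assumes w: "cyclic_word T w" and p: "p \<in> set w" "p \<in> Y" and Y: "\<And>q. q \<in> Y \<Longrightarrow> q \<in> set w \<Longrightarrow> T q \<in> Y"
  shows "set w \<subseteq> Y"
proof
  fix q assume "q \<in> set w"
  obtain i j where ij: "i < length w" "w ! i = p" "j < length w" "w ! j = q"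
    using p \<open>q \<in> set w\<close> by (metis in_set_conv_nth)
  have "w ! ((i + k) mod length w) \<in> Y" for k
  proof (induction k)
    case 0
    then show ?case using ij p by simp
  next
    case (Suc k)
    have lt: "(i + k) mod length w < length w" using ij by (intro mod_less_divisor) linarith
    then have "T (w ! ((i + k) mod length w)) = w ! ((i + Suc k) mod length w)"
      using w by (simp add: cyclic_word_nth mod_Suc_eq)
    then show ?case using Y[OF Suc] lt by simp
  qed
  \<comment> \<open>An additional turn replaces the difference \<open>j - i\<close>, which would be
    truncated for \<open>j < i\<close>.\<close>
  from this[of "length w - i + j"] ij show "q \<in> Y" by simp
qed

text \<open>Injectivity lets a repetition in the orbit be cancelled back to the start, so the orbit
  has no preperiod; the word is the orbit cut off at the least period.\<close>

lemma cyclic_word_exists: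
  assumes fin: "finite X" and inj: "inj_on T X" and cl: "\<And>x. x \<in> X \<Longrightarrow> T x \<in> X" and o: "o' \<in> X"
  obtains w where "cyclic_word T w" "hd w = o'" "set w \<subseteq> X"
proof -
  have mem: "(T ^^ k) o' \<in> X" for k by (induction k) (use o cl in auto)
  have cancel: "(T ^^ (l - k)) o' = o'" if "(T ^^ k) o' = (T ^^ l) o'" "k \<le> l" for k l
    using that
  proof (induction k arbitrary: l)
    case (Suc k)
    then obtain l' where l: "l = Suc l'" by (cases l) auto
    then have "(T ^^ k) o' = (T ^^ l') o'"
      using Suc.prems inj mem by (auto dest: inj_onD)
    with Suc l show ?case by auto
  qed auto
  have "\<not> inj (\<lambda>k. (T ^^ k) o')"
    using fin mem by (metis finite_subset image_subsetI infinite_UNIV_nat finite_imageD)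
  then obtain k l where kl: "k \<noteq> l" "(T ^^ k) o' = (T ^^ l) o'" by (auto simp: inj_def)
  then have "\<exists>n>0. (T ^^ n) o' = o'"
    using cancel[of k l] cancel[of l k] by (metis linorder_neqE_nat order_less_imp_le zero_less_diff)
  then have ex: "\<exists>n. n > 0 \<and> (T ^^ n) o' = o'" .
  define n where "n = (LEAST n. n > 0 \<and> (T ^^ n) o' = o')"
  have n: "n > 0" "(T ^^ n) o' = o'" using LeastI_ex[OF ex] unfolding n_def by auto
  have least: "(T ^^ k) o' \<noteq> o'" if "0 < k" "k < n" for k
    using not_less_Least[of k "\<lambda>n. n > 0 \<and> (T ^^ n) o' = o'"] that unfolding n_def by auto
  let ?w = "map (\<lambda>k. (T ^^ k) o') [0..<n]"
  have "inj_on (\<lambda>k. (T ^^ k) o') {0..<n}"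
  proof (rule linorder_inj_onI)
    fix x y assume "x < y" "x \<in> {0..<n}" "y \<in> {0..<n}"
    then show "(T ^^ x) o' \<noteq> (T ^^ y) o'" using cancel[of x y] least[of "y - x"] by auto
  qed auto
  then have "cyclic_word T ?w"
    using n by (auto simp: cyclic_word_nth distinct_map mod_Suc)
  moreover have "hd ?w = o'" using n by (simp add: hd_map)
  moreover have "set ?w \<subseteq> X" using mem by auto
  ultimately show thesis by (rule that)
qed

text \<open>On the points of \<open>w\<close> the map \<open>T\<close> is the successor map of the
  single circle \<open>w\<close>, so erasing letters gives first returns.\<close>

lemma cyclic_word_filter:
  assumes w: "cyclic_word T w" and ne: "filter P w \<noteq> []"
    and F: "\<And>p. p \<in> set w \<Longrightarrow> P p \<Longrightarrow> ret P T p (F p)"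
  shows "cyclic_word F (filter P w)"
  unfolding cyclic_word_def
proof (intro conjI ballI)
  show "distinct (filter P w)" using w by (simp add: cyclic_word_def)
  fix p assume p: "p \<in> set (filter P w)"
  have "ret P T p (F p)" using p F by auto
  then have "ret P (cnext [w]) p (F p)"
    by (rule ret_cong[where X = "set w"])
      (use w p cyclic_word_closed[OF w] in \<open>auto simp: cyclic_word_def\<close>)
  moreover have "ret P (cnext [w]) p (cnext [filter P w] p)"
    using ret_cnext_filter[of "[w]" p P] w p by (simp add: cyclic_word_def)
  ultimately show "F p = cnext [filter P w] p" by (rule ret_unique)
qed (use ne in auto)

lemma cyclic_word_filter_hd:
  assumes w: "cyclic_word T w" and ne: "filter P w \<noteq> []" and hd: "\<not> P (hd w)"
  shows "ret P T (hd w) (hd (filter P w))"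
proof -
  obtain x v where v: "w = x # v" using w by (cases w) (auto simp: cyclic_word_def)
  have "ret P (cnext [w]) x (hd (filter P (v @ [] @ [x])))"
    using w ne v by (intro ret_cnext[where u = "[]"]) (auto simp: cyclic_word_def filter_empty_conv split: if_splits)
  then have "ret P (cnext [w]) (hd w) (hd (filter P w))" using v hd by simp
  then show ?thesis
    by (rule ret_cong[where X = "set w"])
      (use w cnext_mem[of "[w]" w] in \<open>auto simp: cyclic_word_def\<close>)
qed

text \<open>Converse to filtering. By \<open>reach\<close> the \<open>T\<close>-cycle of
  \<open>o'\<close> meets \<open>P\<close>, hence contains all of \<open>w'\<close>. Moreover
  \<open>T\<close> permutes this cycle and is injective on \<open>X\<close>, so a point whose
  forward orbit enters the cycle already lies on it; again by \<open>reach\<close>, this holds for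
  all of \<open>X\<close>.\<close>

lemma cyclic_word_lift:
  assumes fin: "finite X" and inj: "inj_on T X" and cl: "\<And>x. x \<in> X \<Longrightarrow> T x \<in> X" and o: "o' \<in> X"
    and reach: "\<And>x. x \<in> X \<Longrightarrow> \<exists>k. P ((T ^^ k) x)"
    and F: "\<And>p. p \<in> X \<Longrightarrow> P p \<Longrightarrow> ret P T p (F p)"
    and w': "cyclic_word F w'" "set w' = {p \<in> X. P p}"
  obtains w where "cyclic_word T w" "hd w = o'" "set w = X"
proof -
  obtain w where w: "cyclic_word T w" "hd w = o'" "set w \<subseteq> X"
    using cyclic_word_exists[OF fin inj cl o] by blast
  have ow: "(T ^^ k) o' \<in> set w" for k
    using cyclic_word_set[OF w(1)] w(2) by simp
  obtain k where "P ((T ^^ k) o')" using reach[OF o] by blast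
  then have p: "(T ^^ k) o' \<in> set w'" using ow w w' by auto
  have "set w' \<subseteq> set w"
  proof (rule cyclic_word_subset[OF w'(1) p ow])
    fix q assume "q \<in> set w" "q \<in> set w'"
    then show "F q \<in> set w"
      using ret_mem[OF F[of q] \<open>q \<in> set w\<close> cyclic_word_closed[OF w(1)]] w'(2) by blast
  qed
  have pre: "x \<in> set w" if "x \<in> X" "T x \<in> set w" for x
  proof -
    have "T ` set w = set w"
      using cyclic_word_closed[OF w(1)] inj w(3) by (intro endo_inj_surj) (auto intro: inj_on_subset)
    then have "T x \<in> T ` set w" using that by simp
    then obtain y where "y \<in> set w" "T y = T x" by auto
    then show ?thesis using inj w(3) that by (metis inj_onD subsetD)
  qed
  have "x \<in> set w" if "x \<in> X" "(T ^^ k) x \<in> set w" for x k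
    using that
  proof (induction k arbitrary: x)
    case (Suc k)
    from Suc.prems(2) have "(T ^^ k) (T x) \<in> set w" by (simp add: funpow_swap1)
    then show ?case using Suc.IH[of "T x"] Suc.prems(1) cl pre by blast
  qed auto
  moreover have "(T ^^ k) x \<in> X" if "x \<in> X" for x k
    using that by (induction k) (auto intro: cl)
  ultimately have "X \<subseteq> set w"
    using reach \<open>set w' \<subseteq> set w\<close> w'(2) by (metis (mono_tags, lifting) mem_Collect_eq subset_eq)
  then show thesis using w that by auto
qed

section \<open>The boundary as a word\<close>

primrec prec :: "'a list \<Rightarrow> 'a \<Rightarrow> 'a \<Rightarrow> bool" where
  "prec [] p q \<longleftrightarrow> False"
| "prec (x # w) p q \<longleftrightarrow> x = p \<and> q \<in> set w \<or> prec w p q"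

lemma prec_mem: "prec w p q \<Longrightarrow> p \<in> set w \<and> q \<in> set w"
  by (induction w) auto

lemma prec_filter: "P p \<Longrightarrow> P q \<Longrightarrow> prec (filter P w) p q \<longleftrightarrow> prec w p q"
  by (induction w) auto

lemma prec_map:
  "inj_on g (set w \<union> {p, q}) \<Longrightarrow> prec (map g w) (g p) (g q) \<longleftrightarrow> prec w p q"
proof (induction w)
  case (Cons x w)
  have "g x = g p \<longleftrightarrow> x = p" "g q \<in> g ` set w \<longleftrightarrow> q \<in> set w"
    using inj_on_eq_iff[OF Cons.prems] inj_on_image_mem_iff[OF Cons.prems, of q "set w"] by auto
  moreover have "inj_on g (set w \<union> {p, q})"
    using Cons.prems by (rule inj_on_subset) auto
  ultimately show ?case using Cons.IH by simp
qed auto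

lemma prec_nth: "prec w p q \<longleftrightarrow> (\<exists>i j. i < j \<and> j < length w \<and> w ! i = p \<and> w ! j = q)"
proof (induction w)
  case (Cons x w)
  have "(\<exists>i j. i < j \<and> j < length (x # w) \<and> (x # w) ! i = p \<and> (x # w) ! j = q) \<longleftrightarrow>
      (\<exists>j<length w. x = p \<and> w ! j = q) \<or> (\<exists>i j. i < j \<and> j < length w \<and> w ! i = p \<and> w ! j = q)"
    (is "?l \<longleftrightarrow> ?a \<or> ?b")
  proof
    assume ?l
    then obtain i j where ij: "i < j" "j < length (x # w)" "(x # w) ! i = p" "(x # w) ! j = q" by blast
    then obtain j' where j: "j = Suc j'" by (cases j) auto
    show "?a \<or> ?b"
    proof (cases i)
      case 0
      with ij j show ?thesis by auto
    next
      case (Suc i')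
      with ij j have "i' < j'" "j' < length w" "w ! i' = p" "w ! j' = q" by auto
      then show ?thesis by blast
    qed
  next
    assume "?a \<or> ?b"
    then show ?l
    proof
      assume ?a
      then obtain j where "j < length w" "x = p" "w ! j = q" by blast
      then show ?l by (intro exI[of _ 0] exI[of _ "Suc j"]) auto
    next
      assume ?b
      then obtain i j where "i < j" "j < length w" "w ! i = p" "w ! j = q" by blast
      then show ?l by (intro exI[of _ "Suc i"] exI[of _ "Suc j"]) auto
    qed
  qed
  then show ?case using Cons by (auto simp: in_set_conv_nth)
qed simp

text \<open>The flag \<open>b\<close> treats ascending (\<open>True\<close>) and descending (\<open>False\<close>) diagrams simultaneously.\<close>

definition before :: "bool \<Rightarrow> 'a list \<Rightarrow> 'a \<Rightarrow> 'a \<Rightarrow> bool" where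
  "before b w p q \<longleftrightarrow> (if b then prec w p q else prec w q p)"

lemma before_filter: "P p \<Longrightarrow> P q \<Longrightarrow> before b (filter P w) p q \<longleftrightarrow> before b w p q"
  by (simp add: before_def prec_filter)

lemma before_map:
  "inj_on g (set w \<union> {p, q}) \<Longrightarrow> before b (map g w) (g p) (g q) \<longleftrightarrow> before b w p q"
  by (simp add: before_def prec_map insert_commute)

section \<open>Endpoints, arrows and the trace step\<close>

lemma nth_concat_unique:
  assumes "distinct (concat Cs)" "i < length Cs" "j < length Cs" "x \<in> set (Cs ! i)" "x \<in> set (Cs ! j)"
  shows "i = j"
  using assms
proof (induction Cs arbitrary: i j)
  case (Cons c Cs)
  have "x \<in> set (concat Cs)" if "k < length Cs" "x \<in> set (Cs ! k)" for k
    using that nth_mem[of k Cs] by auto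
  with Cons show ?case by (cases i; cases j) auto
qed auto

lemma opposite_opposite[simp]: "opposite (opposite p) = p"
  by (cases p) auto

lemma opposite_neq[simp]: "opposite p \<noteq> p"
  by (cases p) auto

lemma arrow_of_opposite[simp]: "arrow_of (opposite p) = arrow_of p"
  by (cases p) auto

lemma opposite_map_endpoint: "opposite (map_endpoint f p) = map_endpoint f (opposite p)"
  by (cases p) auto

lemma arrow_of_map_endpoint: "arrow_of (map_endpoint f p) = f (arrow_of p)"
  by (cases p) auto

lemma endpoints_nth: "endpoints D = (\<Union>i<length D. set (D ! i))"
proof -
  have "set D = (!) D ` {..<length D}" by (auto simp: set_conv_nth)
  then show ?thesis by (simp add: endpoints_def)
qed

lemma arrows_mem: "p \<in> endpoints C \<Longrightarrow> arrow_of p \<in> arrows C"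
  by (simp add: arrows_def)

lemma based_diagram_opposite:
  assumes "based_diagram m C"
  shows "opposite p \<in> endpoints C \<longleftrightarrow> p \<in> endpoints C"
  using assms by (cases p) (auto simp: based_diagram_def)

lemma based_diagram_endpoint:
  assumes "based_diagram m C"
  shows "p \<in> endpoints C \<longleftrightarrow> arrow_of p \<in> arrows C"
proof
  assume "arrow_of p \<in> arrows C"
  then obtain q where "q \<in> endpoints C" "arrow_of p = arrow_of q" by (auto simp: arrows_def)
  then show "p \<in> endpoints C"
    using assms by (cases p; cases q) (auto simp: based_diagram_def)
qed (simp add: arrows_mem)

lemma based_diagram_distinct: "based_diagram m C \<Longrightarrow> distinct (concat C)"
  by (simp add: based_diagram_def)

lemma trace_step_eq: "trace_step C p = cnext C (opposite p)"
  by (simp add: trace_step_def next_endpoint_eq_cnext)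

lemma trace_step_closed:
  assumes "based_diagram m C" "p \<in> endpoints C"
  shows "trace_step C p \<in> endpoints C"
  using assms based_diagram_opposite[OF assms(1), of p] cnext_closed[OF based_diagram_distinct, of m C]
  by (auto simp: trace_step_eq endpoints_def)

lemma inj_on_trace_step:
  assumes "based_diagram m C"
  shows "inj_on (trace_step C) (endpoints C)"
proof (rule inj_onI)
  fix p q assume "p \<in> endpoints C" "q \<in> endpoints C" "trace_step C p = trace_step C q"
  then have "opposite p = opposite q"
    using inj_onD[OF inj_on_cnext[OF based_diagram_distinct[OF assms]], of "opposite p" "opposite q"]
      based_diagram_opposite[OF assms]
    by (simp add: trace_step_eq endpoints_def)
  then show "p = q" by (metis opposite_opposite)
qed

lemma finite_endpoints: "finite (endpoints C)"
  by (simp add: endpoints_def)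

section \<open>Ascending and descending diagrams through their boundary words\<close>

lemma orbit_cyclic_word:
  assumes "cyclic_word T w" "p \<in> set w"
  shows "orbit T p = set w"
proof
  show "orbit T p \<subseteq> set w"
  proof
    fix q assume "q \<in> orbit T p"
    then show "q \<in> set w" by induction (simp_all add: cyclic_word_closed[OF assms(1)] assms(2))
  qed
  show "set w \<subseteq> orbit T p"
  proof (rule cyclic_word_subset[OF assms(1)])
    show "T p \<in> set w" by (rule cyclic_word_closed[OF assms])
  qed (auto intro: orbit.intros)
qed

text \<open>With endpoints present there is at least one trace cycle, so any empty circle would give
  a further component. Without empty circles, \<open>hd (D ! 0)\<close> is an endpoint and can serve
  as the start of the single cycle.\<close>

lemma boundary_components_one:
  assumes D: "based_diagram m D" and ne: "endpoints D \<noteq> {}"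
  shows "boundary_components D = 1 \<longleftrightarrow>
    [] \<notin> set D \<and> (\<exists>w. cyclic_word (trace_step D) w \<and> set w = endpoints D \<and> hd w = hd (D ! 0))"
proof -
  have pos: "card (orbit (trace_step D) ` endpoints D) \<ge> 1"
    using ne finite_endpoints[of D] by (simp add: Suc_le_eq card_gt_0_iff)
  have empties: "card {i. i < length D \<and> D ! i = []} = 0 \<longleftrightarrow> [] \<notin> set D"
    by (auto simp: in_set_conv_nth)
  have "boundary_components D = 1 \<longleftrightarrow> [] \<notin> set D \<and> card (orbit (trace_step D) ` endpoints D) = 1"
    using pos empties unfolding boundary_components_def by linarith
  moreover have "card (orbit (trace_step D) ` endpoints D) = 1 \<longleftrightarrow>
      (\<exists>w. cyclic_word (trace_step D) w \<and> set w = endpoints D \<and> hd w = hd (D ! 0))"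
    if e: "[] \<notin> set D"
  proof
    assume "card (orbit (trace_step D) ` endpoints D) = 1"
    then obtain O' where O': "\<And>p. p \<in> endpoints D \<Longrightarrow> orbit (trace_step D) p = O'"
      by (metis card_1_singletonE imageI singletonD)
    have o: "hd (D ! 0) \<in> endpoints D"
    proof -
      have "D ! 0 \<in> set D" using D by (intro nth_mem) (auto simp: based_diagram_def)
      moreover from this have "D ! 0 \<noteq> []" using e by metis
      ultimately show ?thesis unfolding endpoints_def set_concat using hd_in_set by blast
    qed
    obtain w where w: "cyclic_word (trace_step D) w" "hd w = hd (D ! 0)" "set w \<subseteq> endpoints D"
      using cyclic_word_exists[OF finite_endpoints inj_on_trace_step[OF D] trace_step_closed[OF D] o] by blast
    have "hd (D ! 0) \<in> set w" using w(1,2) by (metis cyclic_word_def hd_in_set)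
    then have "set w = O'" using orbit_cyclic_word[OF w(1)] O' o by metis
    have "endpoints D \<subseteq> O'"
    proof
      fix q assume q: "q \<in> endpoints D"
      obtain v where v: "cyclic_word (trace_step D) v" "hd v = q"
        using cyclic_word_exists[OF finite_endpoints inj_on_trace_step[OF D] trace_step_closed[OF D] q] by blast
      then have "q \<in> set v" by (metis cyclic_word_def hd_in_set)
      then show "q \<in> O'" using orbit_cyclic_word[OF v(1)] O' q by metis
    qed
    with w \<open>set w = O'\<close> show "\<exists>w. cyclic_word (trace_step D) w \<and> set w = endpoints D \<and> hd w = hd (D ! 0)" by blast
  next
    assume "\<exists>w. cyclic_word (trace_step D) w \<and> set w = endpoints D \<and> hd w = hd (D ! 0)"
    then obtain w where w: "cyclic_word (trace_step D) w" "set w = endpoints D" by blast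
    then have "orbit (trace_step D) ` endpoints D = {set w}"
      using ne orbit_cyclic_word[OF w(1)] by auto
    then show "card (orbit (trace_step D) ` endpoints D) = 1" by simp
  qed
  ultimately show ?thesis by blast
qed

text \<open>\<open>approached\<close> runs through \<open>w\<close> periodically. The point
  \<open>q\<close> appears at time equal to its index in \<open>w\<close>, so avoiding it before
  time \<open>k\<close> confines \<open>k\<close> to the first turn.\<close>

lemma approached_first_iff:
  assumes w: "cyclic_word (trace_step D) w" "hd w = hd (D ! 0)" and pq: "p \<noteq> q" "q \<in> set w"
  shows "(\<exists>k. approached D k = p \<and> (\<forall>j<k. approached D j \<noteq> q)) \<longleftrightarrow> prec w p q"
proof -
  have app: "approached D k = w ! (k mod length w)" for k
    using cyclic_word_funpow[OF w(1)] w(2) by (simp add: approached_def)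
  have d: "distinct w" "length w > 0" using w by (auto simp: cyclic_word_def)
  obtain j where j: "j < length w" "w ! j = q" using pq by (metis in_set_conv_nth)
  show ?thesis
  proof
    assume "\<exists>k. approached D k = p \<and> (\<forall>j<k. approached D j \<noteq> q)"
    then obtain k where k: "w ! (k mod length w) = p" "\<And>j. j < k \<Longrightarrow> w ! (j mod length w) \<noteq> q"
      by (auto simp: app)
    have "\<not> j < k" using k(2)[of j] j by auto
    moreover have "k mod length w \<noteq> j" using k(1) j pq by auto
    ultimately have "k mod length w < j"
      by (metis linorder_neqE_nat mod_less_eq_dividend order_less_le_trans)
    then show "prec w p q" using j k(1) by (auto simp: prec_nth)
  next
    assume "prec w p q"
    then obtain i j where ij: "i < j" "j < length w" "w ! i = p" "w ! j = q" by (auto simp: prec_nth)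
    have "approached D l \<noteq> q" if "l < i" for l
      using that ij d nth_eq_iff_index_eq[of w l j] by (simp add: app)
    then show "\<exists>k. approached D k = p \<and> (\<forall>j<k. approached D j \<noteq> q)"
      using ij by (intro exI[of _ i]) (auto simp: app)
  qed
qed

definition trace_word :: "bool \<Rightarrow> diagram \<Rightarrow> nat endpoint list \<Rightarrow> bool" where
  "trace_word b D w \<longleftrightarrow> cyclic_word (trace_step D) w \<and> set w = endpoints D \<and> hd w = hd (D ! 0) \<and>
     (\<forall>a\<in>arrows D. before b w (Head a) (Tail a))"

text \<open>The diagram \<open>[[]]\<close> is separate because its boundary meets no endpoint,
  while a cyclic word is never empty.\<close>

definition good :: "bool \<Rightarrow> diagram \<Rightarrow> bool" where
  "good b D \<longleftrightarrow> D = [[]] \<or> D \<noteq> [] \<and> [] \<notin> set D \<and> (\<exists>w. trace_word b D w)"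

lemma endpoints_empty_iff: "endpoints D = {} \<longleftrightarrow> set D \<subseteq> {[]}"
  by (auto simp: endpoints_def)

text \<open>Without endpoints the components are just the circles, so a single component means
  \<open>[[]]\<close>. Otherwise the trace from the base point is a word, and first approaches are
  read off from its order.\<close>

lemma good_iff:
  assumes D: "based_diagram m D"
  shows "boundary_components D = 1 \<and> (if b then ascending D else descending D) \<longleftrightarrow> good b D"
proof (cases "endpoints D = {}")
  case True
  then have all: "D ! i = []" if "i < length D" for i
    using that nth_mem by (fastforce simp: endpoints_empty_iff)
  then have "{i. i < length D \<and> D ! i = []} = {..<length D}" by auto
  then have "boundary_components D = length D"
    using True by (simp add: boundary_components_def)
  moreover have "length D = 1 \<longleftrightarrow> D = [[]]"
    using all by (auto simp: length_Suc_conv)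
  moreover have "arrows D = {}" using True by (simp add: arrows_def)
  moreover have "D \<noteq> []" using D by (simp add: based_diagram_def)
  then have "[] \<in> set D" using True by (cases D) (auto simp: endpoints_empty_iff)
  ultimately show ?thesis by (auto simp: ascending_def descending_def good_def)
next
  case False
  have ex: "\<And>a. a \<in> arrows D \<Longrightarrow> Head a \<in> endpoints D \<and> Tail a \<in> endpoints D"
    using based_diagram_endpoint[OF D] by simp
  have "(if b then ascending D else descending D) \<longleftrightarrow> (\<forall>a\<in>arrows D. before b w (Head a) (Tail a))"
    if w: "cyclic_word (trace_step D) w" "set w = endpoints D" "hd w = hd (D ! 0)" for w
    using approached_first_iff[OF w(1,3)] ex w(2)
    by (auto simp: ascending_def descending_def before_def)
  moreover have "D \<noteq> [[]]" "D \<noteq> []" using False by (auto simp: endpoints_def)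
  ultimately show ?thesis
    unfolding boundary_components_one[OF D False] good_def trace_word_def by blast
qed

text \<open>The single boundary cycle visits every circle and changes circles only across an arrow.
  Hence the endpoints on circles reachable from \<open>i\<close> form an invariant set, which must
  be everything.\<close>

lemma good_connected:
  assumes D: "based_diagram m D" and g: "good b D"
  shows "connected_diagram D"
proof (cases "D = [[]]")
  case True
  then show ?thesis by (auto simp: connected_diagram_def)
next
  case False
  with g obtain w where ne: "[] \<notin> set D" and w: "cyclic_word (trace_step D) w" "set w = endpoints D"
    by (auto simp: good_def trace_word_def)
  let ?R = "{(i, j). i < length D \<and> j < length D \<and> (\<exists>p\<in>set (D ! i). opposite p \<in> set (D ! j))}"
  have "(i, j) \<in> ?R\<^sup>*" if ij: "i < length D" "j < length D" for i j
  proof -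
    let ?Y = "{q. \<exists>l<length D. q \<in> set (D ! l) \<and> (i, l) \<in> ?R\<^sup>*}"
    have in_end: "p \<in> endpoints D \<longleftrightarrow> (\<exists>l<length D. p \<in> set (D ! l))" for p
      by (auto simp: endpoints_nth)
    obtain p q where p: "p \<in> set (D ! i)" and q: "q \<in> set (D ! j)"
      using ij ne by (metis last_in_set nth_mem)
    have "set w \<subseteq> ?Y"
    proof (rule cyclic_word_subset[OF w(1)])
      show "p \<in> set w" using p ij w(2) in_end by blast
      show "p \<in> ?Y" using p ij by blast
    next
      fix r assume "r \<in> ?Y" "r \<in> set w"
      then obtain l where l: "l < length D" "r \<in> set (D ! l)" "(i, l) \<in> ?R\<^sup>*" by blast
      have "opposite r \<in> endpoints D"
        using \<open>r \<in> set w\<close> w(2) based_diagram_opposite[OF D] by simp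
      then obtain l' where l': "l' < length D" "opposite r \<in> set (D ! l')" using in_end by blast
      with l have "(l, l') \<in> ?R" by blast
      then have "(i, l') \<in> ?R\<^sup>*" using l(3) by (rule rtrancl_into_rtrancl[rotated])
      moreover have "trace_step D r \<in> set (D ! l')"
        using cnext_mem[OF based_diagram_distinct[OF D]] l' by (simp add: trace_step_eq)
      ultimately show "trace_step D r \<in> ?Y" using l'(1) by blast
    qed
    then obtain l where "l < length D" "q \<in> set (D ! l)" "(i, l) \<in> ?R\<^sup>*"
      using q ij w(2) in_end by blast
    then show ?thesis
      using nth_concat_unique[OF based_diagram_distinct[OF D], of l j q] q ij by simp
  qed
  then show ?thesis unfolding connected_diagram_def by blast
qed

section \<open>Isomorphisms\<close>

text \<open>An isomorphism without the normalisation of \<open>f\<close> outside the arrows, so that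
  inverses and composites are again of this form.\<close>

definition iso_via :: "(nat \<Rightarrow> nat) \<Rightarrow> (nat \<Rightarrow> nat) \<Rightarrow> diagram \<Rightarrow> diagram \<Rightarrow> bool" where
  "iso_via s f A B \<longleftrightarrow> length A = length B \<and> s permutes {..<length A} \<and> s 0 = 0 \<and>
     inj_on f (arrows A) \<and> B ! 0 = map (map_endpoint f) (A ! 0) \<and>
     (\<forall>i<length A. \<exists>k. rotate k (B ! s i) = map (map_endpoint f) (A ! i))"

lemma rotate_back: "\<exists>l. rotate l (rotate k xs) = xs"
proof
  have "rotate (length xs * k - k) (rotate k xs) = rotate (length xs * k) xs" if "xs \<noteq> []"
    using that by (simp add: rotate_rotate Suc_le_eq)
  then show "rotate (length xs * k - k) (rotate k xs) = xs"
    by (cases "xs = []") (simp_all add: rotate_id)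
qed

lemma map_endpoint_inv_into:
  assumes "inj_on f (arrows A)" "p \<in> endpoints A"
  shows "map_endpoint (inv_into (arrows A) f) (map_endpoint f p) = p"
  using arrows_mem[OF assms(2)] assms(1) by (cases p) auto

lemma inj_on_map_endpoint: "inj_on f (arrows A) \<Longrightarrow> inj_on (map_endpoint f) (endpoints A)"
  by (metis inj_on_inverseI map_endpoint_inv_into)

lemma iso_via_nth:
  assumes "iso_via s f A B" "i < length A"
  shows "s i < length B" "set (B ! s i) = map_endpoint f ` set (A ! i)"
proof -
  show "s i < length B"
    using assms permutes_in_image[of s "{..<length A}" i] by (auto simp: iso_via_def)
  from assms obtain k where "rotate k (B ! s i) = map (map_endpoint f) (A ! i)"
    by (auto simp: iso_via_def)
  then show "set (B ! s i) = map_endpoint f ` set (A ! i)"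
    by (metis list.set_map set_rotate)
qed

lemma iso_via_endpoints:
  assumes "iso_via s f A B"
  shows "endpoints B = map_endpoint f ` endpoints A"
proof -
  have s: "s ` {..<length A} = {..<length B}"
    using assms permutes_image by (fastforce simp: iso_via_def)
  have "endpoints B = (\<Union>i\<in>s ` {..<length A}. set (B ! i))"
    unfolding s endpoints_nth ..
  also have "\<dots> = map_endpoint f ` endpoints A"
    unfolding endpoints_nth using iso_via_nth[OF assms] by auto
  finally show ?thesis .
qed

lemma iso_via_arrows:
  assumes "iso_via s f A B"
  shows "arrows B = f ` arrows A"
  unfolding arrows_def iso_via_endpoints[OF assms] by (simp add: image_image arrow_of_map_endpoint)

lemma iso_via_sym:
  assumes iso: "iso_via s f A B" and ne: "A \<noteq> []"
  shows "iso_via (inv s) (inv_into (arrows A) f) B A"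
proof -
  let ?g = "inv_into (arrows A) f"
  from iso have len: "length A = length B" and s: "s permutes {..<length A}" "s 0 = 0"
    and f: "inj_on f (arrows A)" and b: "B ! 0 = map (map_endpoint f) (A ! 0)"
    and r: "\<And>i. i < length A \<Longrightarrow> \<exists>k. rotate k (B ! s i) = map (map_endpoint f) (A ! i)"
    by (auto simp: iso_via_def)
  have undo: "map (map_endpoint ?g) (map (map_endpoint f) (A ! i)) = A ! i" if "i < length A" for i
    unfolding map_map using that map_endpoint_inv_into[OF f]
    by (intro map_idI) (auto simp: endpoints_nth)
  have "inj_on ?g (arrows B)"
    unfolding iso_via_arrows[OF iso] by (rule inj_on_inv_into) simp
  moreover have "\<exists>k. rotate k (A ! inv s j) = map (map_endpoint ?g) (B ! j)" if j: "j < length B" for j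
  proof -
    define i where "i = inv s j"
    have i: "i < length A" "s i = j"
      using j len s permutes_inv[OF s(1)] permutes_in_image[of "inv s" "{..<length A}" j]
      by (auto simp: i_def permutes_inverses)
    from r[OF i(1)] obtain k where k: "rotate k (B ! j) = map (map_endpoint f) (A ! i)" using i by auto
    have "rotate k (map (map_endpoint ?g) (B ! j)) = A ! i"
      using undo[OF i(1)] k by (metis rotate_map)
    then show ?thesis using rotate_back[of k "map (map_endpoint ?g) (B ! j)"] i_def by auto
  qed
  moreover have "inv s 0 = 0" using s by (metis permutes_inverses(2))
  moreover have "A ! 0 = map (map_endpoint ?g) (B ! 0)"
    using b undo[of 0] ne by simp
  ultimately show ?thesis
    using len s permutes_inv[OF s(1)] by (simp add: iso_via_def)
qed

lemma iso_via_trans: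
  assumes AB: "iso_via s f A B" and BC: "iso_via t g B C" and "A \<noteq> []"
  shows "iso_via (t \<circ> s) (g \<circ> f) A C"
proof -
  have me: "map_endpoint (g \<circ> f) = map_endpoint g \<circ> map_endpoint f"
    by (simp add: endpoint.map_comp fun_eq_iff)
  have "\<exists>k. rotate k (C ! t (s i)) = map (map_endpoint (g \<circ> f)) (A ! i)" if i: "i < length A" for i
  proof -
    from AB i obtain k where k: "rotate k (B ! s i) = map (map_endpoint f) (A ! i)"
      by (auto simp: iso_via_def)
    from BC iso_via_nth(1)[OF AB i] obtain l where l: "rotate l (C ! t (s i)) = map (map_endpoint g) (B ! s i)"
      by (auto simp: iso_via_def)
    have "rotate (k + l) (C ! t (s i)) = map (map_endpoint (g \<circ> f)) (A ! i)"
      unfolding me map_map[symmetric] k[symmetric] by (simp add: rotate_rotate[symmetric] l rotate_map)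
    then show ?thesis by blast
  qed
  moreover have "inj_on (g \<circ> f) (arrows A)"
    using AB BC iso_via_arrows[OF AB] by (intro comp_inj_on) (auto simp: iso_via_def)
  moreover have "C ! 0 = map (map_endpoint (g \<circ> f)) (A ! 0)"
    using AB BC by (simp add: iso_via_def me)
  ultimately show ?thesis using AB BC by (auto simp: iso_via_def intro: permutes_compose)
qed

text \<open>On each circle the isomorphism is a rotation, which shifts all indices by the same
  amount and therefore commutes with the cyclic successor.\<close>

lemma cnext_iso:
  assumes A: "distinct (concat A)" and B: "distinct (concat B)" and iso: "iso_via s f A B"
    and p: "p \<in> endpoints A"
  shows "cnext B (map_endpoint f p) = map_endpoint f (cnext A p)"
proof -
  let ?g = "map_endpoint f"
  from p obtain i where i: "i < length A" "p \<in> set (A ! i)" by (auto simp: endpoints_nth)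
  then obtain k where k: "k < length (A ! i)" "p = A ! i ! k" by (metis in_set_conv_nth)
  from iso i obtain r where r: "rotate r (B ! s i) = map ?g (A ! i)" by (auto simp: iso_via_def)
  define d l where "d = B ! s i" and "l = length (A ! i)"
  have l: "length d = l" "l > 0" using r k by (metis d_def l_def length_map length_rotate) (use k l_def in auto)
  have d: "d \<in> set B" using iso_via_nth(1)[OF iso i(1)] by (simp add: d_def)
  have nth: "?g (A ! i ! j) = d ! ((r + j) mod l)" if "j < l" for j
  proof -
    have "?g (A ! i ! j) = rotate r d ! j" using that by (simp add: r d_def l_def)
    then show ?thesis using that l by (simp add: nth_rotate)
  qed
  have "cnext B (?g p) = d ! (Suc ((r + k) mod l) mod l)"
    using cnext_nth[OF B d, of "(r + k) mod l"] l nth[of k] k by (simp add: l_def)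
  also have "\<dots> = ?g (A ! i ! (Suc k mod l))"
    using nth[of "Suc k mod l"] l by (simp add: mod_Suc_eq mod_add_right_eq)
  also have "A ! i ! (Suc k mod l) = cnext A p"
    using cnext_nth[OF A nth_mem[OF i(1)] k(1)] k by (simp add: l_def)
  finally show ?thesis .
qed

lemma cyclic_word_map:
  assumes w: "cyclic_word T w" and g: "inj_on g (set w)" and T: "\<And>p. p \<in> set w \<Longrightarrow> T' (g p) = g (T p)"
  shows "cyclic_word T' (map g w)"
  using assms by (auto simp: cyclic_word_nth distinct_map)

text \<open>An isomorphism conjugates the trace steps and matches the based circles letter by
  letter, so it carries the boundary word together with its starting point.\<close>

lemma good_iso:
  assumes A: "based_diagram m A" and B: "based_diagram m B" and iso: "iso_via s f A B" and g: "good b A"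
  shows "good b B"
proof (cases "A = [[]]")
  case True
  then have "length B = 1" "B ! 0 = []" using iso by (auto simp: iso_via_def)
  then have "B = [[]]" by (cases B) auto
  then show ?thesis by (simp add: good_def)
next
  case False
  with g obtain w where w: "trace_word b A w" and ne: "[] \<notin> set A" "A \<noteq> []" by (auto simp: good_def)
  let ?g = "map_endpoint f"
  have wE: "set w = endpoints A" and wc: "cyclic_word (trace_step A) w" using w by (auto simp: trace_word_def)
  have f: "inj_on f (arrows A)" using iso by (simp add: iso_via_def)
  have step: "trace_step B (?g p) = ?g (trace_step A p)" if "p \<in> endpoints A" for p
    using that cnext_iso[OF A[THEN based_diagram_distinct] B[THEN based_diagram_distinct] iso]
      based_diagram_opposite[OF A]
    by (simp add: trace_step_eq opposite_map_endpoint)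
  have "trace_word b B (map ?g w)"
    unfolding trace_word_def
  proof (intro conjI ballI)
    show "cyclic_word (trace_step B) (map ?g w)"
      using wc inj_on_map_endpoint[OF f] step wE by (intro cyclic_word_map) auto
    show "set (map ?g w) = endpoints B"
      using wE iso_via_endpoints[OF iso] by simp
    have "A ! 0 \<noteq> []" using ne by (metis length_greater_0_conv nth_mem)
    then show "hd (map ?g w) = hd (B ! 0)"
      using w wc iso by (simp add: trace_word_def cyclic_word_def iso_via_def hd_map)
    fix a assume "a \<in> arrows B"
    then obtain c where c: "c \<in> arrows A" "a = f c" using iso_via_arrows[OF iso] by auto
    have "before b (map ?g w) (?g (Head c)) (?g (Tail c)) \<longleftrightarrow> before b w (Head c) (Tail c)"
      using c(1) based_diagram_endpoint[OF A] wE
      by (intro before_map inj_on_subset[OF inj_on_map_endpoint[OF f]]) auto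
    then show "before b (map ?g w) (Head a) (Tail a)"
      using w c by (simp add: trace_word_def)
  qed
  moreover have "[] \<notin> set B"
  proof
    assume "[] \<in> set B"
    then obtain j where j: "j < length B" "B ! j = []" by (auto simp: in_set_conv_nth)
    have "s ` {..<length A} = {..<length B}" using iso permutes_image by (fastforce simp: iso_via_def)
    then obtain i where "i < length A" "s i = j" using j by (metis imageE lessThan_iff)
    then have "A ! i = []" using iso_via_nth(2)[OF iso, of i] j by simp
    then show False using ne \<open>i < length A\<close> by (metis nth_mem)
  qed
  moreover have "B \<noteq> []" using B by (simp add: based_diagram_def)
  ultimately show ?thesis by (auto simp: good_def)
qed

section \<open>Normalised homomorphisms and rigidity\<close>

lemma restrict_circle_arrows:
  assumes "c \<in> set C"
  shows "restrict_circle (arrows C) c = c"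
proof -
  have "arrow_of p \<in> arrows C" if "p \<in> set c" for p
    using that assms by (intro arrows_mem) (auto simp: endpoints_def)
  then show ?thesis by (simp add: restrict_circle_def filter_id_conv)
qed

lemma iso_via_homs:
  assumes "(s, f) \<in> homs A B" "f ` arrows A = arrows B" "A \<noteq> []"
  shows "iso_via s f A B"
proof -
  have "restrict_circle (arrows B) (B ! s i) = B ! s i" if "i < length A" for i
    using that assms(1) permutes_in_image[of s "{..<length A}" i]
    by (intro restrict_circle_arrows nth_mem) (auto simp: homs_def)
  moreover have "restrict_circle (arrows B) (B ! 0) = B ! 0"
    using assms(1,3) by (intro restrict_circle_arrows nth_mem) (auto simp: homs_def)
  ultimately show ?thesis
    using assms by (auto simp: homs_def iso_via_def)
qed

lemma homs_iso_via:
  assumes iso: "iso_via s f A B" and "A \<noteq> []"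
  shows "(s, restrict f (arrows A)) \<in> homs A B"
proof -
  have "restrict_circle (arrows B) (B ! s i) = B ! s i" if "i < length A" for i
    using that iso_via_nth(1)[OF iso] by (intro restrict_circle_arrows nth_mem)
  moreover have "restrict_circle (arrows B) (B ! 0) = B ! 0"
    using assms by (intro restrict_circle_arrows nth_mem) (auto simp: iso_via_def)
  moreover have m: "map (map_endpoint (restrict f (arrows A))) (A ! i) = map (map_endpoint f) (A ! i)"
    if "i < length A" for i
  proof (rule map_cong[OF refl])
    fix p assume "p \<in> set (A ! i)"
    then have "arrow_of p \<in> arrows A" using that arrows_mem by (auto simp: endpoints_nth)
    then show "map_endpoint (restrict f (arrows A)) p = map_endpoint f p" by (cases p) auto
  qed
  moreover have "length B = length A" "s permutes {..<length A}" "s 0 = 0" "inj_on f (arrows A)"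
    "B ! 0 = map (map_endpoint f) (A ! 0)" "\<forall>i<length A. \<exists>k. rotate k (B ! s i) = map (map_endpoint f) (A ! i)"
    "0 < length A"
    using assms unfolding iso_via_def by auto
  ultimately show ?thesis
    using iso_via_arrows[OF iso] by (simp add: homs_def del: map_eq_conv)
qed

lemma diagram_iso_iff:
  assumes "A \<noteq> []"
  shows "diagram_iso A B \<longleftrightarrow> (\<exists>s f. iso_via s f A B)"
proof
  assume "diagram_iso A B"
  then show "\<exists>s f. iso_via s f A B"
    unfolding diagram_iso_def using iso_via_homs[OF _ _ assms] by blast
next
  assume "\<exists>s f. iso_via s f A B"
  then obtain s f where iso: "iso_via s f A B" by blast
  then have "restrict f (arrows A) ` arrows A = arrows B"
    by (simp add: iso_via_arrows)
  with homs_iso_via[OF iso assms] show "diagram_iso A B"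
    unfolding diagram_iso_def by blast
qed

text \<open>The based circle is read from the base point and leaves no freedom. Connectedness
  propagates this: once one endpoint of an arrow has a known image, so has the other, and the image
  of a single point fixes both the target circle and the rotation.\<close>

lemma iso_via_rigid:
  assumes A: "connected_diagram A" "A \<noteq> []" and B: "distinct (concat B)"
    and f: "iso_via s f A B" and f': "iso_via s' f' A B" and i: "i < length A"
  shows "s i = s' i \<and> map (map_endpoint f) (A ! i) = map (map_endpoint f') (A ! i)"
proof -
  let ?R = "{(i, j). i < length A \<and> j < length A \<and> (\<exists>p\<in>set (A ! i). opposite p \<in> set (A ! j))}"
  have "(0, i) \<in> ?R\<^sup>*" using A i unfolding connected_diagram_def by blast
  then show ?thesis
  proof (induction rule: rtrancl_induct)
    case base
    then show ?case using f f' by (auto simp: iso_via_def)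
  next
    case (step i j)
    then obtain p where ij: "i < length A" "j < length A" and p: "p \<in> set (A ! i)" "opposite p \<in> set (A ! j)" by blast
    have "map_endpoint f p = map_endpoint f' p" using step.IH p(1) by auto
    then have q: "map_endpoint f (opposite p) = map_endpoint f' (opposite p)"
      by (simp add: opposite_map_endpoint[symmetric])
    have "map_endpoint f (opposite p) \<in> set (B ! s j)"
      using iso_via_nth(2)[OF f ij(2)] p(2) by simp
    moreover have "map_endpoint f (opposite p) \<in> set (B ! s' j)"
      unfolding q using iso_via_nth(2)[OF f' ij(2)] p(2) by simp
    ultimately    have s: "s j = s' j"
      using nth_concat_unique[OF B] iso_via_nth(1)[OF f ij(2)] iso_via_nth(1)[OF f' ij(2)] by blast
    obtain k k' where k: "rotate k (B ! s j) = map (map_endpoint f) (A ! j)"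
      "rotate k' (B ! s j) = map (map_endpoint f') (A ! j)"
      using f f' ij(2) s unfolding iso_via_def by metis
    define c where "c = B ! s j"
    have dc: "distinct c"
      using distinct_concat_mem[OF B nth_mem[OF iso_via_nth(1)[OF f ij(2)]]] by (simp add: c_def)
    obtain l where l: "l < length (A ! j)" "A ! j ! l = opposite p" using p(2) by (metis in_set_conv_nth)
    have len: "length c = length (A ! j)" using k(1) by (metis c_def length_map length_rotate)
    have "rotate k c ! l = rotate k' c ! l" using k l q by (simp add: c_def)
    then have "c ! ((k + l) mod length c) = c ! ((k' + l) mod length c)"
      using l len by (simp add: nth_rotate)
    then have "(k + l) mod length c = (k' + l) mod length c"
      using dc l len nth_eq_iff_index_eq[OF dc] by (metis mod_less_divisor length_pos_if_in_set p(2))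
    then have "k mod length c = k' mod length c"
      by (auto simp: nat_mod_eq_iff)
    then have "rotate k c = rotate k' c" by (metis rotate_conv_mod)
    then show ?case using s k by (simp add: c_def)
  qed
qed

section \<open>The state sum\<close>

definition isos :: "diagram \<Rightarrow> diagram \<Rightarrow> ((nat \<Rightarrow> nat) \<times> (nat \<Rightarrow> nat)) set" where
  "isos A B = {(s, f) \<in> homs A B. f ` arrows A = arrows B}"

text \<open>Rigidity determines \<open>s\<close> on the circles and \<open>f\<close> on the arrows;
  the normalisation in \<open>homs\<close> then makes the pair itself unique.\<close>

lemma card_isos:
  assumes A: "connected_diagram A" "A \<noteq> []" and B: "distinct (concat B)"
  shows "card (isos A B) = (if diagram_iso A B then 1 else 0)"
proof (cases "diagram_iso A B")
  case True
  then obtain s f where sf: "(s, f) \<in> isos A B" by (auto simp: diagram_iso_def isos_def)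
  have "(s', f') = (s, f)" if "(s', f') \<in> isos A B" for s' f'
  proof -
    have iso: "iso_via s f A B" "iso_via s' f' A B"
      using that sf iso_via_homs A(2) by (auto simp: isos_def)
    note rigid = iso_via_rigid[OF A B iso]
    have "s' i = s i" for i
    proof (cases "i < length A")
      case False
      then show ?thesis
        using iso permutes_not_in unfolding iso_via_def by (metis lessThan_iff)
    qed (use rigid in auto)
    moreover have "f' a = f a" for a
    proof (cases "a \<in> arrows A")
      case True
      then obtain i p where p: "i < length A" "p \<in> set (A ! i)" "arrow_of p = a"
        by (auto simp: arrows_def endpoints_nth)
      then have "map_endpoint f p = map_endpoint f' p" using rigid[of i] by auto
      then show ?thesis using p(3) by (cases p) auto
    next
      case False
      then show ?thesis using that sf by (auto simp: isos_def homs_def PiE_def extensional_def)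
    qed
    ultimately show ?thesis by (simp add: fun_eq_iff)
  qed
  then have "\<phi> = (s, f)" if "\<phi> \<in> isos A B" for \<phi>
    using that by (cases \<phi>) simp
  with sf have "isos A B = {(s, f)}" by blast
  then show ?thesis using True by simp
next
  case False
  then have "isos A B = {}" by (auto simp: diagram_iso_def isos_def)
  then show ?thesis using False by simp
qed

section \<open>Subdiagrams spanned by states\<close>

definition restrict_diagram :: "nat set \<Rightarrow> diagram \<Rightarrow> diagram" where
  "restrict_diagram S C = map (restrict_circle S) C"

lemma endpoints_restrict: "endpoints (restrict_diagram S C) = {p \<in> endpoints C. arrow_of p \<in> S}"
  by (auto simp: endpoints_def restrict_diagram_def restrict_circle_def)

lemma arrows_restrict: "arrows (restrict_diagram S C) = S \<inter> arrows C"
  by (auto simp: arrows_def endpoints_restrict)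

lemma restrict_restrict: "restrict_diagram S (restrict_diagram T C) = restrict_diagram (T \<inter> S) C"
  by (simp add: restrict_diagram_def restrict_circle_def conj_commute)

lemma based_diagram_restrict:
  assumes "based_diagram m C"
  shows "based_diagram m (restrict_diagram S C)"
proof -
  have "concat (restrict_diagram S C) = filter (\<lambda>p. arrow_of p \<in> S) (concat C)"
    by (simp add: restrict_diagram_def restrict_circle_def[abs_def] filter_concat)
  moreover have "restrict_diagram S C \<noteq> []" "length (restrict_diagram S C) = m"
    using assms by (auto simp: based_diagram_def restrict_diagram_def)
  ultimately show ?thesis
    using assms by (auto simp: based_diagram_def endpoints_restrict)
qed

text \<open>A homomorphism sees its target only through the endpoints of its image arrows, so fixing
  the image \<open>S\<close> amounts to replacing the target by the subdiagram of
  \<open>S\<close>.\<close>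

lemma isos_restrict:
  assumes S: "S \<subseteq> arrows C" and C: "C \<noteq> []"
  shows "isos A (restrict_diagram S C) = {\<phi> \<in> homs A C. snd \<phi> ` arrows A = S}"
proof -
  have *: "S \<inter> arrows C = S" using S by blast
  have rr: "restrict_circle S (restrict_diagram S C ! i) = restrict_circle S (C ! i)" if "i < length C" for i
    using that by (simp add: restrict_diagram_def restrict_circle_def)
  have pi: "s i < length C" if "s permutes {..<length C}" "i < length C" for s i
    using permutes_in_image[OF that(1)] that(2) by auto
  have "(s, f) \<in> homs A (restrict_diagram S C) \<longleftrightarrow> (s, f) \<in> homs A C" if f: "f ` arrows A = S" for s f
  proof -
    have "f \<in> arrows A \<rightarrow>\<^sub>E S \<longleftrightarrow> f \<in> arrows A \<rightarrow>\<^sub>E arrows C"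
      using f S by (auto simp: PiE_def)
    moreover have "length (restrict_diagram S C) = length C" by (simp add: restrict_diagram_def)
    ultimately show ?thesis
      using C rr[of 0] rr[OF pi] by (auto simp: homs_def f arrows_restrict *)
  qed
  then show ?thesis by (auto simp: isos_def arrows_restrict *)
qed

lemma finite_homs: "finite (homs A C)"
proof (rule finite_subset)
  show "homs A C \<subseteq> {s. s permutes {..<length A}} \<times> (arrows A \<rightarrow>\<^sub>E arrows C)"
    by (auto simp: homs_def)
  show "finite ({s. s permutes {..<length A}} \<times> (arrows A \<rightarrow>\<^sub>E arrows C))"
    by (intro finite_cartesian_product finite_permutations finite_PiE) (auto simp: finite_arrows)
qed

text \<open>Homomorphisms are grouped by their image; by rigidity each group has at most one
  element, and the sign depends only on the image.\<close>

lemma pairing_states: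
  assumes A: "connected_diagram A" "A \<noteq> []" and G: "based_diagram m (circles G)"
  shows "pairing A G = (\<Sum>S\<in>Pow (arrows (circles G)).
    if diagram_iso A (restrict_diagram S (circles G)) then \<Prod>a\<in>S. sign G a else 0)"
proof -
  let ?C = "circles G"
  have "pairing A G = (\<Sum>S\<in>Pow (arrows ?C). \<Sum>\<phi>\<in>{\<phi> \<in> homs A ?C. snd \<phi> ` arrows A = S}. hom_sign A G \<phi>)"
    unfolding pairing_def by (rule sum.group[symmetric]) (simp_all add: finite_homs finite_arrows, auto simp: homs_def)
  also have "\<dots> = (\<Sum>S\<in>Pow (arrows ?C).
      if diagram_iso A (restrict_diagram S ?C) then \<Prod>a\<in>S. sign G a else 0)"
  proof (rule sum.cong[OF refl])
    fix S assume S: "S \<in> Pow (arrows ?C)"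
    have C: "?C \<noteq> []" using G by (simp add: based_diagram_def)
    have "(\<Sum>\<phi>\<in>{\<phi> \<in> homs A ?C. snd \<phi> ` arrows A = S}. hom_sign A G \<phi>) =
        (\<Sum>\<phi>\<in>isos A (restrict_diagram S ?C). \<Prod>a\<in>S. sign G a)"
      using S C by (intro sum.cong) (auto simp: isos_restrict hom_sign_def)
    then show "(\<Sum>\<phi>\<in>{\<phi> \<in> homs A ?C. snd \<phi> ` arrows A = S}. hom_sign A G \<phi>) =
        (if diagram_iso A (restrict_diagram S ?C) then \<Prod>a\<in>S. sign G a else 0)"
      using card_isos[OF A based_diagram_distinct[OF based_diagram_restrict[OF G]]] by simp
  qed
  finally show ?thesis .
qed

section \<open>Summing over isomorphism classes\<close>

definition good_diagrams :: "bool \<Rightarrow> nat \<Rightarrow> nat \<Rightarrow> diagram set" where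
  "good_diagrams b n m = {A. based_diagram m A \<and> good b A \<and> card (arrows A) = n}"

lemma good_diagrams_eq:
  "{A \<in> one_component_diagrams n m. if b then ascending A else descending A} = good_diagrams b n m"
proof -
  have "arrow_diagram m A \<and> card (arrows A) = n \<and> boundary_components A = 1 \<and>
      (if b then ascending A else descending A) \<longleftrightarrow>
    based_diagram m A \<and> good b A \<and> card (arrows A) = n" for A
    using good_iff[of m A b] good_connected[of m A b] unfolding arrow_diagram_def by blast
  then show ?thesis unfolding one_component_diagrams_def good_diagrams_def by blast
qed

lemma iso_rel_iff:
  "(A, B) \<in> iso_rel m \<longleftrightarrow> arrow_diagram m A \<and> arrow_diagram m B \<and> (\<exists>s f. iso_via s f A B)"
  using diagram_iso_iff by (auto simp: iso_rel_def arrow_diagram_def based_diagram_def)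

lemma iso_rel_sym: "(A, B) \<in> iso_rel m \<Longrightarrow> (B, A) \<in> iso_rel m"
  unfolding iso_rel_iff arrow_diagram_def based_diagram_def using iso_via_sym by blast

lemma iso_rel_trans: "(A, B) \<in> iso_rel m \<Longrightarrow> (B, C) \<in> iso_rel m \<Longrightarrow> (A, C) \<in> iso_rel m"
  unfolding iso_rel_iff arrow_diagram_def based_diagram_def using iso_via_trans by blast

lemma iso_rel_refl: "arrow_diagram m A \<Longrightarrow> (A, A) \<in> iso_rel m"
  using diagram_iso_refl by (simp add: iso_rel_def)

lemma iso_rel_class_eq: "(A, B) \<in> iso_rel m \<Longrightarrow> iso_rel m `` {A} = iso_rel m `` {B}"
  using iso_rel_sym iso_rel_trans by blast

lemma iso_rel_good_diagrams:
  assumes "A \<in> good_diagrams b n m" "based_diagram m B" "diagram_iso A B"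
  shows "B \<in> good_diagrams b n m" "(A, B) \<in> iso_rel m"
proof -
  have A: "based_diagram m A" "good b A" "A \<noteq> []"
    using assms by (auto simp: good_diagrams_def based_diagram_def)
  obtain s f where iso: "iso_via s f A B" using assms(3) diagram_iso_iff[OF A(3)] by blast
  have B: "good b B" using good_iso[OF A(1) assms(2) iso A(2)] .
  then show "B \<in> good_diagrams b n m"
    using assms diagram_iso_card by (auto simp: good_diagrams_def)
  show "(A, B) \<in> iso_rel m"
    using iso A B assms(2) good_connected unfolding iso_rel_iff arrow_diagram_def by blast
qed

lemma good_diagrams_arrow_diagram: "A \<in> good_diagrams b n m \<Longrightarrow> arrow_diagram m A"
  using good_connected by (auto simp: good_diagrams_def arrow_diagram_def)

text \<open>Renaming the arrows to \<open>{..<n}\<close> gives each class a representative among the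
  finitely many lists of \<open>m\<close> repetition-free words over the \<open>2 * n\<close>
  endpoints. Finiteness matters because a sum over an infinite index set would be zero by
  convention.\<close>

lemma finite_good_classes: "finite (good_diagrams b n m // iso_rel m)"
proof (rule finite_subset)
  define P :: "nat endpoint set" where "P = Tail ` {..<n} \<union> Head ` {..<n}"
  define F where "F = {B. set B \<subseteq> {c. set c \<subseteq> P \<and> distinct c} \<and> length B = m}"
  show "finite ((\<lambda>B. iso_rel m `` {B}) ` F)"
    unfolding F_def P_def
    by (intro finite_imageI finite_lists_length_eq finite_subset_distinct) auto
  show "good_diagrams b n m // iso_rel m \<subseteq> (\<lambda>B. iso_rel m `` {B}) ` F"
  proof
    fix X assume "X \<in> good_diagrams b n m // iso_rel m"
    then obtain A where A: "A \<in> good_diagrams b n m" "X = iso_rel m `` {A}" by (rule quotientE)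
    then have bA: "based_diagram m A" "card (arrows A) = n" by (auto simp: good_diagrams_def)
    obtain g where g: "bij_betw g (arrows A) {..<n}"
      using bA(2) finite_arrows[of A] by (metis ex_bij_betw_finite_nat lessThan_atLeast0)
    then have inj: "inj_on g (arrows A)" by (rule bij_betw_imp_inj_on)
    define B where "B = map (map (map_endpoint g)) A"
    have A0: "A \<noteq> []" using bA by (simp add: based_diagram_def)
    have iso: "iso_via id g A B"
      using inj A0 by (auto simp: iso_via_def B_def permutes_id intro!: exI[of _ 0])
    have cB: "concat B = map (map_endpoint g) (concat A)" by (simp add: B_def map_concat)
    have dB: "distinct (concat B)"
      unfolding cB using bA inj_on_map_endpoint[OF inj] by (simp add: distinct_map based_diagram_def endpoints_def)
    have "p \<in> endpoints B \<longleftrightarrow> arrow_of p \<in> arrows B" for p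
    proof
      assume "arrow_of p \<in> arrows B"
      then obtain a where a: "a \<in> arrows A" "arrow_of p = g a" using iso_via_arrows[OF iso] by auto
      have "Head a \<in> endpoints A" "Tail a \<in> endpoints A" using a based_diagram_endpoint[OF bA(1)] by auto
      then have "map_endpoint g (Head a) \<in> endpoints B" "map_endpoint g (Tail a) \<in> endpoints B"
        unfolding iso_via_endpoints[OF iso] by blast+
      then show "p \<in> endpoints B" using a by (cases p) auto
    qed (rule arrows_mem)
    then have bB: "based_diagram m B"
      using bA dB by (auto simp: based_diagram_def B_def)
    have "set c \<subseteq> P \<and> distinct c" if c: "c \<in> set B" for c
    proof
      show "distinct c" using distinct_concat_mem[OF dB c] .
      show "set c \<subseteq> P"
      proof
        fix p assume "p \<in> set c"
        then have "arrow_of p \<in> arrows B" using c by (auto simp: arrows_def endpoints_def)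
        then have "arrow_of p \<in> {..<n}" using g iso_via_arrows[OF iso] by (simp add: bij_betw_def)
        then show "p \<in> P" by (cases p) (auto simp: P_def)
      qed
    qed
    then have "B \<in> F" using bB by (auto simp: F_def based_diagram_def)
    moreover have "(A, B) \<in> iso_rel m"
      using A(1) bB iso diagram_iso_iff[OF A0] by (intro iso_rel_good_diagrams(2)) auto
    ultimately show "X \<in> (\<lambda>B. iso_rel m `` {B}) ` F"
      using A(2) iso_rel_class_eq by blast
  qed
qed

definition state_weight :: "gauss_diagram \<Rightarrow> nat \<Rightarrow> nat set \<Rightarrow> int" where
  "state_weight G n S = (if card S = n then \<Prod>a\<in>S. sign G a else 0)"

definition state_sum :: "bool \<Rightarrow> nat \<Rightarrow> gauss_diagram \<Rightarrow> int" where
  "state_sum b n G = (\<Sum>S\<in>Pow (arrows (circles G)).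
     if good b (restrict_diagram S (circles G)) then state_weight G n S else 0)"

text \<open>After exchanging the two sums, a state \<open>S\<close> contributes to at most one
  class: that of its own subdiagram, provided this is good and has \<open>n\<close> arrows.\<close>

lemma sum_class_pairing:
  assumes G: "based_diagram m (circles G)"
  shows "(\<Sum>X\<in>good_diagrams b n m // iso_rel m. class_pairing X G) = state_sum b n G"
proof -
  let ?Q = "good_diagrams b n m // iso_rel m"
  let ?C = "circles G"
  define rep where "rep X = (SOME A. A \<in> X)" for X :: "diagram set"
  have rep: "rep X \<in> good_diagrams b n m \<and> X = iso_rel m `` {rep X}" if "X \<in> ?Q" for X
  proof -
    from that obtain A where A: "A \<in> good_diagrams b n m" "X = iso_rel m `` {A}" by (rule quotientE)
    then have "A \<in> X" using iso_rel_refl good_diagrams_arrow_diagram by blast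
    then have "rep X \<in> X" unfolding rep_def by (rule someI)
    then have r: "(A, rep X) \<in> iso_rel m" using A by blast
    then have "rep X \<in> good_diagrams b n m"
      using A(1) iso_rel_good_diagrams(1) by (auto simp: iso_rel_def arrow_diagram_def)
    then show ?thesis using A(2) iso_rel_class_eq[OF r] by blast
  qed
  have classes: "{X \<in> ?Q. diagram_iso (rep X) D} =
      (if D \<in> good_diagrams b n m then {iso_rel m `` {D}} else {})" if D: "based_diagram m D" for D
  proof -
    have "D \<in> good_diagrams b n m \<and> X = iso_rel m `` {D}" if "X \<in> ?Q" "diagram_iso (rep X) D" for X
      using rep[OF that(1)] iso_rel_good_diagrams[OF _ D that(2)] iso_rel_class_eq by blast
    moreover have "iso_rel m `` {D} \<in> ?Q \<and> diagram_iso (rep (iso_rel m `` {D})) D"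
      if g: "D \<in> good_diagrams b n m"
    proof
      show Q: "iso_rel m `` {D} \<in> ?Q" using g by (rule quotientI)
      have "D \<in> iso_rel m `` {rep (iso_rel m `` {D})}"
        using rep[OF Q] iso_rel_refl[OF good_diagrams_arrow_diagram[OF g]] by blast
      then have "(rep (iso_rel m `` {D}), D) \<in> iso_rel m" by blast
      then show "diagram_iso (rep (iso_rel m `` {D})) D" unfolding iso_rel_def by blast
    qed
    ultimately show ?thesis by auto
  qed
  have "(\<Sum>X\<in>?Q. class_pairing X G) = (\<Sum>X\<in>?Q. \<Sum>S\<in>Pow (arrows ?C).
      if diagram_iso (rep X) (restrict_diagram S ?C) then \<Prod>a\<in>S. sign G a else 0)"
  proof (rule sum.cong[OF refl])
    fix X assume X: "X \<in> ?Q"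
    have "connected_diagram (rep X)" "rep X \<noteq> []"
      using rep[OF X] good_diagrams_arrow_diagram[of "rep X" b n m] by (auto simp: arrow_diagram_def based_diagram_def)
    from pairing_states[OF this G]
    show "class_pairing X G = (\<Sum>S\<in>Pow (arrows ?C).
        if diagram_iso (rep X) (restrict_diagram S ?C) then \<Prod>a\<in>S. sign G a else 0)"
      by (simp add: class_pairing_def rep_def)
  qed
  also have "\<dots> = (\<Sum>S\<in>Pow (arrows ?C). \<Sum>X\<in>?Q.
      if diagram_iso (rep X) (restrict_diagram S ?C) then \<Prod>a\<in>S. sign G a else 0)"
    by (rule sum.swap)
  also have "\<dots> = state_sum b n G"
    unfolding state_sum_def
  proof (rule sum.cong[OF refl])
    fix S assume S: "S \<in> Pow (arrows ?C)"
    let ?D = "restrict_diagram S ?C"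
    have D: "based_diagram m ?D" using G by (rule based_diagram_restrict)
    have "arrows ?D = S" using S by (auto simp: arrows_restrict)
    then have gD: "?D \<in> good_diagrams b n m \<longleftrightarrow> good b ?D \<and> card S = n"
      using D by (simp add: good_diagrams_def)
    have "(\<Sum>X\<in>?Q. if diagram_iso (rep X) ?D then \<Prod>a\<in>S. sign G a else 0) =
        (\<Sum>X\<in>{X \<in> ?Q. diagram_iso (rep X) ?D}. \<Prod>a\<in>S. sign G a)"
      by (rule sum.inter_filter[symmetric]) (rule finite_good_classes)
    then show "(\<Sum>X\<in>?Q. if diagram_iso (rep X) ?D then \<Prod>a\<in>S. sign G a else 0) =
        (if good b ?D then state_weight G n S else 0)"
      unfolding classes[OF D] gD by (simp add: state_weight_def)
  qed
  finally show ?thesis .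
qed

lemma asc_coeff_eq: "based_diagram m (circles G) \<Longrightarrow> asc_coeff n m G = state_sum True n G"
  using sum_class_pairing[of m G True n] good_diagrams_eq[of n m True]
  by (simp add: asc_coeff_def ascending_classes_def)

lemma desc_coeff_eq: "based_diagram m (circles G) \<Longrightarrow> desc_coeff n m G = state_sum False n G"
  using sum_class_pairing[of m G False n] good_diagrams_eq[of n m False]
  by (simp add: desc_coeff_def descending_classes_def)

lemma nabla_eqI:
  assumes "based_gauss_diagram m G" "based_gauss_diagram m H"
    and "\<And>b n. state_sum b n G = state_sum b n H"
  shows "nabla_asc G = nabla_asc H \<and> nabla_des G = nabla_des H"
  using assms
  by (auto simp: poly_eq_iff coeff_nabla_asc coeff_nabla_des asc_coeff_eq desc_coeff_eq
      based_gauss_diagram_def based_diagram_def)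

section \<open>The first two moves\<close>

lemma prec_antisym:
  assumes "distinct w" "prec w p q"
  shows "\<not> prec w q p"
  using assms by (induction w) (auto dest: prec_mem)

lemma prec_total: "p \<in> set w \<Longrightarrow> q \<in> set w \<Longrightarrow> p \<noteq> q \<Longrightarrow> prec w p q \<or> prec w q p"
  by (induction w) auto

lemma prec_trans: "prec w p q \<Longrightarrow> prec w q r \<Longrightarrow> distinct w \<Longrightarrow> prec w p r"
  by (induction w) (auto dest: prec_mem)

lemma cyclic_word_succ:
  assumes w: "cyclic_word T w" and p: "p \<in> set w" "T p \<noteq> hd w"
  obtains k where "Suc k < length w" "w ! k = p" "w ! Suc k = T p"
proof -
  obtain k where k: "k < length w" "w ! k = p" using p by (metis in_set_conv_nth)
  have T: "T p = w ! (Suc k mod length w)" using w k by (auto simp: cyclic_word_nth)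
  have "Suc k \<noteq> length w"
    using T p(2) w by (auto simp: cyclic_word_def hd_conv_nth)
  with k T that[of k] show thesis by simp
qed

text \<open>Unless the word wraps around at \<open>p\<close>, the point \<open>T p\<close> stands
  directly after \<open>p\<close>, and no third point fits between them.\<close>

lemma prec_succ:
  assumes w: "cyclic_word T w" and p: "p \<in> set w" "T p \<noteq> hd w"
  shows "prec w p (T p)"
    and "q \<noteq> p \<Longrightarrow> q \<noteq> T p \<Longrightarrow> prec w (T p) q \<longleftrightarrow> prec w p q"
    and "q \<noteq> p \<Longrightarrow> q \<noteq> T p \<Longrightarrow> prec w q (T p) \<longleftrightarrow> prec w q p"
proof -
  obtain k where k: "Suc k < length w" "w ! k = p" "w ! Suc k = T p"
    using cyclic_word_succ[OF assms] .
  have d: "distinct w" using w by (simp add: cyclic_word_def)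
  show pT: "prec w p (T p)" using k by (auto simp: prec_nth)
  have "prec w (T p) q" if "prec w p q" "q \<noteq> T p" for q
  proof -
    obtain i j where ij: "i < j" "j < length w" "w ! i = p" "w ! j = q"
      using \<open>prec w p q\<close> by (auto simp: prec_nth)
    have "i = k" using ij k d nth_eq_iff_index_eq[OF d, of i k] by simp
    moreover have "j \<noteq> Suc k" using ij k that by auto
    ultimately have "Suc k < j" using ij by linarith
    then show ?thesis using ij k by (auto simp: prec_nth)
  qed
  then show "q \<noteq> p \<Longrightarrow> q \<noteq> T p \<Longrightarrow> prec w (T p) q \<longleftrightarrow> prec w p q"
    using prec_trans[OF pT _ d] by blast
  have "prec w q p" if "prec w q (T p)" "q \<noteq> p" for q
  proof -
    obtain i j where ij: "i < j" "j < length w" "w ! i = q" "w ! j = T p"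
      using \<open>prec w q (T p)\<close> by (auto simp: prec_nth)
    have "j = Suc k" using ij k d nth_eq_iff_index_eq[OF d, of j "Suc k"] by simp
    moreover have "i \<noteq> k" using ij k that by auto
    ultimately have "i < k" using ij by linarith
    then show ?thesis using ij(3) k unfolding prec_nth by (metis Suc_lessD)
  qed
  then show "q \<noteq> p \<Longrightarrow> q \<noteq> T p \<Longrightarrow> prec w q (T p) \<longleftrightarrow> prec w q p"
    using prec_trans[OF _ pT d] by blast
qed

lemma before_succ:
  assumes w: "cyclic_word T w" and p: "p \<in> set w" "T p \<noteq> hd w" and q: "q \<noteq> p" "q \<noteq> T p"
  shows "before b w (T p) q \<longleftrightarrow> before b w p q" "before b w q (T p) \<longleftrightarrow> before b w q p"
  using prec_succ[OF w p] q by (simp_all add: before_def)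

lemma before_antisym: "distinct w \<Longrightarrow> before b w p q \<Longrightarrow> \<not> before b w q p"
  by (auto simp: before_def dest: prec_antisym split: if_splits)

text \<open>\<open>Y\<close> is invariant under the trace, so the endpoint \<open>p\<close> in
  \<open>Y\<close> and the endpoint \<open>r\<close> outside cannot lie on a common boundary
  cycle.\<close>

lemma not_good_closed:
  assumes p: "p \<in> Y" "p \<in> endpoints D" and Y: "\<And>q. q \<in> Y \<Longrightarrow> trace_step D q \<in> Y"
    and r: "r \<in> endpoints D" "r \<notin> Y"
  shows "\<not> good b D"
proof
  assume "good b D"
  moreover have "D \<noteq> [[]]" using p by (auto simp: endpoints_def)
  ultimately obtain w where w: "cyclic_word (trace_step D) w" "set w = endpoints D"
    by (auto simp: good_def trace_word_def)
  have "set w \<subseteq> Y" by (rule cyclic_word_subset[OF w(1)]) (use p Y w in auto)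
  then show False using r w by auto
qed

section \<open>Adjacent endpoints\<close>

lemma adjacent_restrict:
  assumes "adjacent C p q" "arrow_of p \<in> S" "arrow_of q \<in> S"
  shows "adjacent (restrict_diagram S C) p q"
proof -
  from assms(1) obtain c u v where c: "c \<in> set C" "c = u @ [p, q] @ v"
    by (auto simp: adjacent_def sublist_def)
  then have "restrict_circle S c = restrict_circle S u @ [p, q] @ restrict_circle S v"
    using assms by (simp add: restrict_circle_def)
  then have "sublist [p, q] (restrict_circle S c)" unfolding sublist_def by blast
  then show ?thesis using c(1) by (auto simp: adjacent_def restrict_diagram_def)
qed

lemma cnext_adjacent:
  assumes "distinct (concat C)" "adjacent C p q"
  shows "cnext C p = q"
proof -
  from assms(2) obtain u v where "u @ p # (q # v) \<in> set C"
    by (auto simp: adjacent_def sublist_def)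
  from cnext_split[OF assms(1) this] show ?thesis by simp
qed

lemma adjacent_endpoints:
  assumes "adjacent C p q"
  shows "p \<in> endpoints C \<and> q \<in> endpoints C"
proof -
  from assms obtain c where "c \<in> set C" "sublist [p, q] c" by (auto simp: adjacent_def)
  moreover from this have "{p, q} \<subseteq> set c" by (auto simp: sublist_def)
  ultimately show ?thesis by (auto simp: endpoints_def)
qed

text \<open>Adjacency is read inside the uncut word, where \<open>p\<close> precedes
  \<open>q\<close>, so \<open>q\<close> cannot come first after the base point. This keeps the pair
  from straddling the start of the boundary word.\<close>

lemma hd_not_adjacent:
  assumes d: "distinct (concat C)" and ne: "C \<noteq> []" "[] \<notin> set C" and adj: "adjacent C p q"
  shows "hd (C ! 0) \<noteq> q"
proof
  assume hd: "hd (C ! 0) = q"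
  from adj obtain c u v where c: "c \<in> set C" "c = u @ [p, q] @ v"
    by (auto simp: adjacent_def sublist_def)
  have C0: "C ! 0 \<in> set C" using ne(1) by simp
  then have "C ! 0 \<noteq> []" using ne(2) by metis
  then have "q \<in> set (C ! 0)" using hd by (metis hd_in_set)
  then have "c = C ! 0" using distinct_concatD[OF d c(1) C0, of q] c(2) by simp
  then have "hd (u @ [p, q] @ v) = q" using hd c by simp
  then show False using distinct_concat_mem[OF d c(1)] c(2) by (cases u) auto
qed

section \<open>Splitting state sums and the first move\<close>

lemma sum_Pow_insert:
  fixes F :: "'a set \<Rightarrow> 'b::comm_monoid_add"
  assumes "finite A" "x \<notin> A"
  shows "sum F (Pow (insert x A)) = (\<Sum>S\<in>Pow A. F S + F (insert x S))"
proof -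
  have "inj_on (insert x) (Pow A)" using assms(2) by (auto simp: inj_on_def)
  moreover have "Pow A \<inter> insert x ` Pow A = {}" using assms(2) by auto
  ultimately show ?thesis
    using assms(1) by (simp add: Pow_insert sum.union_disjoint sum.reindex sum.distrib)
qed

lemma delete_arrows_eq:
  "circles (delete_arrows S G) = restrict_diagram (- S) (circles G)" "sign (delete_arrows S G) = sign G"
  by (simp_all add: delete_arrows_def restrict_diagram_def)

lemma state_sum_delete:
  "state_sum b n (delete_arrows T G) = (\<Sum>S\<in>Pow (arrows (circles G) - T).
     if good b (restrict_diagram S (circles G)) then state_weight G n S else 0)"
  unfolding state_sum_def
proof (rule sum.cong)
  show "Pow (arrows (circles (delete_arrows T G))) = Pow (arrows (circles G) - T)"
    unfolding delete_arrows_eq arrows_restrict by blast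
  fix S assume "S \<in> Pow (arrows (circles G) - T)"
  then have "- T \<inter> S = S" by blast
  then show "(if good b (restrict_diagram S (circles (delete_arrows T G))) then state_weight (delete_arrows T G) n S else 0) =
      (if good b (restrict_diagram S (circles G)) then state_weight G n S else 0)"
    unfolding delete_arrows_eq restrict_restrict by (simp add: state_weight_def delete_arrows_eq)
qed

text \<open>Having approached \<open>opposite p\<close>, the trace jumps to \<open>p\<close> and
  moves on to \<open>opposite p\<close> again. This fixed point is a boundary component that misses
  \<open>p\<close>.\<close>

lemma not_good_kink:
  assumes D: "based_diagram m D" and adj: "adjacent D p (opposite p)"
  shows "\<not> good b D"
proof (rule not_good_closed[where Y = "{opposite p}"])
  show "opposite p \<in> endpoints D" "p \<in> endpoints D" using adjacent_endpoints[OF adj] by auto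
  show "trace_step D q \<in> {opposite p}" if "q \<in> {opposite p}" for q
    using that cnext_adjacent[OF based_diagram_distinct[OF D] adj] by (simp add: trace_step_eq)
qed (simp_all add: opposite_neq[symmetric] del: opposite_neq)

lemma state_sum_omega1:
  assumes H: "based_diagram m (circles H)" and "omega1 G H"
  shows "state_sum b n G = state_sum b n H"
proof -
  from \<open>omega1 G H\<close> obtain a where a: "a \<in> arrows (circles H)" and G: "G = delete_arrows {a} H"
    and adj: "adjacent (circles H) (Tail a) (Head a) \<or> adjacent (circles H) (Head a) (Tail a)"
    by (auto simp: omega1_def)
  then obtain p where p: "adjacent (circles H) p (opposite p)" "arrow_of p = a"
    by (metis opposite.simps endpoint.sel)
  show ?thesis
    unfolding G state_sum_delete unfolding state_sum_def
  proof (rule sum.mono_neutral_left)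
    show "\<forall>S\<in>Pow (arrows (circles H)) - Pow (arrows (circles H) - {a}).
        (if good b (restrict_diagram S (circles H)) then state_weight H n S else 0) = 0"
    proof
      fix S assume "S \<in> Pow (arrows (circles H)) - Pow (arrows (circles H) - {a})"
      then have "a \<in> S" by blast
      then have "adjacent (restrict_diagram S (circles H)) p (opposite p)"
        using p by (intro adjacent_restrict) auto
      from not_good_kink[OF based_diagram_restrict[OF H] this]
      show "(if good b (restrict_diagram S (circles H)) then state_weight H n S else 0) = 0" by simp
    qed
  qed (auto simp: finite_arrows)
qed

text \<open>Nothing separates \<open>p\<close> from \<open>q\<close>, so keeping only the one or
  only the other gives the same word up to its name. The third alternative concerns circles that the
  pair does not meet.\<close>

lemma relabel_adjacent:
  assumes c: "distinct c" and pq: "p \<noteq> q" "\<not> P p" "\<not> P q"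
    and adj: "sublist [p, q] c \<or> sublist [q, p] c \<or> p \<notin> set c \<and> q \<notin> set c"
  shows "map (id(p := q)) (filter (\<lambda>x. P x \<or> x = p) c) = filter (\<lambda>x. P x \<or> x = q) c"
proof -
  have off: "map (id(p := q)) (filter (\<lambda>x. P x \<or> x = p) u) = filter (\<lambda>x. P x \<or> x = q) u"
    if "p \<notin> set u" "q \<notin> set u" for u
  proof -
    have "filter (\<lambda>x. P x \<or> x = p) u = filter P u" "filter (\<lambda>x. P x \<or> x = q) u = filter P u"
      using that by (auto intro: filter_cong)
    moreover have "map (id(p := q)) (filter P u) = filter P u"
      using pq by (intro map_idI) auto
    ultimately show ?thesis by simp
  qed
  from adj consider u v where "c = u @ [p, q] @ v" | u v where "c = u @ [q, p] @ v"
    | "p \<notin> set c \<and> q \<notin> set c"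
    by (auto simp: sublist_def)
  then show ?thesis
  proof cases
    case 1
    then have "p \<notin> set u" "q \<notin> set u" "p \<notin> set v" "q \<notin> set v" using c by auto
    then show ?thesis using off[of u] off[of v] pq unfolding 1 by simp
  next
    case 2
    then have "p \<notin> set u" "q \<notin> set u" "p \<notin> set v" "q \<notin> set v" using c by auto
    then show ?thesis using off[of u] off[of v] pq unfolding 2 by simp
  qed (use off in blast)
qed

lemma adjacent_in_circle:
  assumes "distinct (concat C)" "c \<in> set C" "adjacent C p q"
  shows "sublist [p, q] c \<or> p \<notin> set c \<and> q \<notin> set c"
proof -
  from assms(3) obtain d where d: "d \<in> set C" "sublist [p, q] d" by (auto simp: adjacent_def)
  then have "p \<in> set d" "q \<in> set d" by (auto simp: sublist_def)
  then show ?thesis using distinct_concatD[OF assms(1,2) d(1)] d(2) by blast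
qed

text \<open>The arrow is slid in two stages, first its tail and then its head, through the
  intermediate word containing \<open>Tail b\<close> and \<open>Head a\<close>; each stage moves one
  endpoint to the adjacent place.\<close>

lemma iso_via_relabel:
  assumes C: "based_diagram m C" and ab: "a \<noteq> b" "a \<notin> S" "b \<notin> S" "a \<in> arrows C"
    and tails: "adjacent C (Tail a) (Tail b)"
    and heads: "adjacent C (Head a) (Head b) \<or> adjacent C (Head b) (Head a)"
  shows "iso_via id (id(a := b)) (restrict_diagram (insert a S) C) (restrict_diagram (insert b S) C)"
proof -
  let ?f = "id(a := b)"
  have d: "distinct (concat C)" using C by (rule based_diagram_distinct)
  have "map (map_endpoint ?f) (restrict_circle (insert a S) c) = restrict_circle (insert b S) c" if c: "c \<in> set C" for c
  proof -
    have dc: "distinct c" using distinct_concat_mem[OF d c] .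
    have 1: "map (id(Tail a := Tail b)) (filter (\<lambda>x. (arrow_of x \<in> S \<or> x = Head a) \<or> x = Tail a) c) =
        filter (\<lambda>x. (arrow_of x \<in> S \<or> x = Head a) \<or> x = Tail b) c"
      using adjacent_in_circle[OF d c tails] ab by (intro relabel_adjacent dc) auto
    have 2: "map (id(Head a := Head b)) (filter (\<lambda>x. (arrow_of x \<in> S \<or> x = Tail b) \<or> x = Head a) c) =
        filter (\<lambda>x. (arrow_of x \<in> S \<or> x = Tail b) \<or> x = Head b) c"
      using adjacent_in_circle[OF d c] heads ab by (intro relabel_adjacent dc) auto
    have e: "arrow_of x = k \<longleftrightarrow> x = Head k \<or> x = Tail k" for x :: "nat endpoint" and k by (cases x) auto
    have m: "map (map_endpoint ?f) (restrict_circle (insert a S) c) =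
        map (id(Head a := Head b)) (map (id(Tail a := Tail b)) (restrict_circle (insert a S) c))"
      unfolding map_map
    proof (rule map_cong[OF refl])
      show "map_endpoint ?f x = (id(Head a := Head b) \<circ> id(Tail a := Tail b)) x" for x by (cases x) auto
    qed
    have a: "restrict_circle (insert a S) c = filter (\<lambda>x. (arrow_of x \<in> S \<or> x = Head a) \<or> x = Tail a) c"
      unfolding restrict_circle_def by (rule filter_cong) (auto simp: e)
    have b: "filter (\<lambda>x. (arrow_of x \<in> S \<or> x = Head a) \<or> x = Tail b) c =
        filter (\<lambda>x. (arrow_of x \<in> S \<or> x = Tail b) \<or> x = Head a) c"
      by (rule filter_cong) auto
    have c: "filter (\<lambda>x. (arrow_of x \<in> S \<or> x = Tail b) \<or> x = Head b) c = restrict_circle (insert b S) c"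
      unfolding restrict_circle_def by (rule filter_cong) (auto simp: e)
    show ?thesis unfolding m unfolding a 1 b 2 c ..
  qed
  moreover have "C \<noteq> []" using C by (simp add: based_diagram_def)
  moreover have "inj_on ?f (arrows (restrict_diagram (insert a S) C))"
    using ab by (auto simp: inj_on_def arrows_restrict)
  ultimately show ?thesis
    by (auto simp: iso_via_def restrict_diagram_def permutes_id intro!: exI[of _ 0])
qed

lemma good_iso_iff:
  assumes A: "based_diagram m A" and B: "based_diagram m B" and iso: "iso_via s f A B"
  shows "good b A \<longleftrightarrow> good b B"
proof -
  have "A \<noteq> []" using A by (simp add: based_diagram_def)
  from iso_via_sym[OF iso this] show ?thesis
    using good_iso[OF A B iso] good_iso[OF B A] by blast
qed

text \<open>If \<open>Head b'\<close> precedes \<open>Head a\<close>, the trace leads from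
  \<open>Tail b'\<close> to \<open>Head a\<close> and back, a component of its own. If
  \<open>Head a\<close> precedes \<open>Head b'\<close>, then \<open>Tail a\<close> is followed at
  once by \<open>Head b'\<close> and \<open>Head a\<close> by \<open>Tail b'\<close>; so the
  required order of the ends of \<open>b'\<close> forces the wrong order of the ends of
  \<open>a\<close>.\<close>

lemma not_good_bigon:
  assumes D: "based_diagram m D" and ab: "a \<noteq> b'"
    and tails: "adjacent D (Tail a) (Tail b')"
    and heads: "adjacent D (Head a) (Head b') \<or> adjacent D (Head b') (Head a)"
  shows "\<not> good b D"
proof -
  have d: "distinct (concat D)" using D by (rule based_diagram_distinct)
  have E: "Tail a \<in> endpoints D" "Tail b' \<in> endpoints D" "Head a \<in> endpoints D" "Head b' \<in> endpoints D"
    using adjacent_endpoints tails heads by auto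
  note t = cnext_adjacent[OF d tails]
  from heads show ?thesis
  proof
    assume adj: "adjacent D (Head b') (Head a)"
    show ?thesis
    proof (rule not_good_closed[where Y = "{Tail b', Head a}" and p = "Tail b'" and r = "Tail a"])
      show "trace_step D q \<in> {Tail b', Head a}" if "q \<in> {Tail b', Head a}" for q
        using that t cnext_adjacent[OF d adj] by (auto simp: trace_step_eq)
    qed (use E ab in auto)
  next
    assume adj: "adjacent D (Head a) (Head b')"
    show ?thesis
    proof
      assume g: "good b D"
      have "D \<noteq> [[]]" using E by (auto simp: endpoints_def)
      with g obtain w where ne: "D \<noteq> []" "[] \<notin> set D" and w: "cyclic_word (trace_step D) w"
        "set w = endpoints D" "hd w = hd (D ! 0)" "\<forall>a\<in>arrows D. before b w (Head a) (Tail a)"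
        by (auto simp: good_def trace_word_def)
      have step: "trace_step D (Tail a) = Head b'" "trace_step D (Head a) = Tail b'"
        using t cnext_adjacent[OF d adj] by (auto simp: trace_step_eq)
      have hd: "Head b' \<noteq> hd w" "Tail b' \<noteq> hd w"
        using hd_not_adjacent[OF d ne adj] hd_not_adjacent[OF d ne tails] w(3) by auto
      have "before b w (Head a) (Tail a)" "before b w (Head b') (Tail b')"
        using w(4) arrows_mem[OF E(1)] arrows_mem[OF E(2)] by auto
      then have "before b w (Tail a) (Tail b')"
        using before_succ(1)[OF w(1), of "Tail a" "Tail b'" b] step hd E w(2) ab by simp
      then have "before b w (Tail a) (Head a)"
        using before_succ(2)[OF w(1), of "Head a" "Tail a" b] step hd E w(2) ab by simp
      then show False
        using before_antisym[of w b] \<open>before b w (Head a) (Tail a)\<close> w(1) by (auto simp: cyclic_word_def)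
    qed
  qed
qed

lemma state_sum_omega2:
  assumes H: "based_diagram m (circles H)" and "omega2 G H"
  shows "state_sum b n G = state_sum b n H"
proof -
  let ?C = "circles H"
  from \<open>omega2 G H\<close> obtain a b' where a: "a \<in> arrows ?C" "b' \<in> arrows ?C" "a \<noteq> b'"
    and sgn: "sign H b' = - sign H a" and G: "G = delete_arrows {a, b'} H"
    and tails: "adjacent ?C (Tail a) (Tail b')"
    and heads: "adjacent ?C (Head a) (Head b') \<or> adjacent ?C (Head b') (Head a)"
    by (auto simp: omega2_def)
  define F where "F S = (if good b (restrict_diagram S ?C) then state_weight H n S else 0)" for S
  let ?A = "arrows ?C - {a, b'}"
  have A: "arrows ?C = insert a (insert b' ?A)" using a by blast
  have fin: "finite ?A" by (simp add: finite_arrows)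
  have "state_sum b n H = sum F (Pow (insert a (insert b' ?A)))"
    unfolding state_sum_def F_def A[symmetric] ..
  also have "\<dots> = (\<Sum>S\<in>Pow ?A. F S + F (insert b' S) + (F (insert a S) + F (insert a (insert b' S))))"
    using fin a(3) by (simp add: sum_Pow_insert sum.distrib add_ac)
  also have "\<dots> = (\<Sum>S\<in>Pow ?A. F S)"
  proof (rule sum.cong[OF refl])
    fix S assume S: "S \<in> Pow ?A"
    then have fS: "finite S" "a \<notin> S" "b' \<notin> S" using fin finite_subset by auto
    have "good b (restrict_diagram (insert a S) ?C) \<longleftrightarrow> good b (restrict_diagram (insert b' S) ?C)"
      using iso_via_relabel[OF H a(3) fS(2,3) a(1) tails heads]
      by (intro good_iso_iff[OF based_diagram_restrict[OF H] based_diagram_restrict[OF H]])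
    then have "F (insert b' S) + F (insert a S) = 0"
      using fS sgn by (simp add: F_def state_weight_def)
    moreover have "F (insert a (insert b' S)) = 0"
      using not_good_bigon[OF based_diagram_restrict[OF H] a(3)] tails heads
      unfolding F_def by (metis adjacent_restrict endpoint.sel insertCI)
    ultimately show "F S + F (insert b' S) + (F (insert a S) + F (insert a (insert b' S))) = F S" by simp
  qed
  also have "\<dots> = state_sum b n G"
    unfolding G state_sum_delete F_def ..
  finally show ?thesis by simp
qed

section \<open>Invariance under isomorphisms of Gauss diagrams\<close>

lemma filter_rotate: "\<exists>l. filter P (rotate k xs) = rotate l (filter P xs)"
proof -
  have "rotate k xs = drop (k mod length xs) xs @ take (k mod length xs) xs" by (rule rotate_drop_take)
  moreover have "rotate (length (filter P u)) (filter P (u @ v)) = filter P (v @ u)" for u v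
    by (simp add: rotate_append)
  from this[of "take (k mod length xs) xs" "drop (k mod length xs) xs"]
  have "rotate (length (filter P (take (k mod length xs) xs))) (filter P xs) =
      filter P (drop (k mod length xs) xs @ take (k mod length xs) xs)" by (simp only: append_take_drop_id)
  ultimately show ?thesis by metis
qed

lemma iso_via_restrict:
  assumes iso: "iso_via s f A B" and S: "S \<subseteq> arrows A" and ne: "A \<noteq> []"
  shows "iso_via s f (restrict_diagram S A) (restrict_diagram (f ` S) B)"
proof -
  have f: "inj_on f (arrows A)" using iso by (simp add: iso_via_def)
  have r: "restrict_circle (f ` S) (map (map_endpoint f) (A ! i)) = map (map_endpoint f) (restrict_circle S (A ! i))"
    if "i < length A" for i
  proof -
    have "f (arrow_of p) \<in> f ` S \<longleftrightarrow> arrow_of p \<in> S" if "p \<in> set (A ! i)" for p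
      using that \<open>i < length A\<close> inj_on_image_mem_iff[OF f _ S] arrows_mem[of p A] by (auto simp: endpoints_nth)
    then show ?thesis
      unfolding restrict_circle_def filter_map by (auto simp: arrow_of_map_endpoint intro!: arg_cong[where f = "map _"] filter_cong)
  qed
  have "\<exists>k. rotate k (restrict_circle (f ` S) (B ! s i)) = map (map_endpoint f) (restrict_circle S (A ! i))"
    if i: "i < length A" for i
  proof -
    obtain k where "rotate k (B ! s i) = map (map_endpoint f) (A ! i)" using iso i by (auto simp: iso_via_def)
    then show ?thesis
      using r[OF i] filter_rotate[of _ k "B ! s i"] by (metis restrict_circle_def)
  qed
  moreover have "inj_on f (arrows (restrict_diagram S A))"
    by (rule inj_on_subset[OF f]) (auto simp: arrows_restrict)
  moreover have "length A = length B" "s permutes {..<length A}" "s 0 = 0"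
    "B ! 0 = map (map_endpoint f) (A ! 0)" "0 < length A"
    using iso ne unfolding iso_via_def by auto
  ultimately show ?thesis
    using r[of 0] iso_via_nth(1)[OF iso] f by (simp add: iso_via_def restrict_diagram_def)
qed

lemma state_sum_gauss_iso:
  assumes G: "based_diagram m (circles G)" and H: "based_diagram m (circles H)" and iso: "gauss_iso G H"
  shows "state_sum b n G = state_sum b n H"
proof -
  have ne: "circles G \<noteq> []" using G by (simp add: based_diagram_def)
  from iso obtain s f where sf: "(s, f) \<in> homs (circles G) (circles H)"
    "f ` arrows (circles G) = arrows (circles H)"
    and sgn: "\<And>a. a \<in> arrows (circles G) \<Longrightarrow> sign H (f a) = sign G a"
    by (auto simp: gauss_iso_def)
  then have via: "iso_via s f (circles G) (circles H)" using ne by (intro iso_via_homs)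
  then have f: "inj_on f (arrows (circles G))" by (simp add: iso_via_def)
  have "state_sum b n H = (\<Sum>S\<in>(`) f ` Pow (arrows (circles G)).
      if good b (restrict_diagram S (circles H)) then state_weight H n S else 0)"
    unfolding state_sum_def sf(2)[symmetric] by (simp add: image_Pow_surj)
  also have "\<dots> = (\<Sum>S\<in>Pow (arrows (circles G)).
      if good b (restrict_diagram (f ` S) (circles H)) then state_weight H n (f ` S) else 0)"
    using inj_on_image_Pow[OF f] by (simp add: sum.reindex)
  also have "\<dots> = state_sum b n G"
    unfolding state_sum_def
  proof (rule sum.cong[OF refl])
    fix S assume "S \<in> Pow (arrows (circles G))"
    then have S: "S \<subseteq> arrows (circles G)" by simp
    have fS: "inj_on f S" using inj_on_subset[OF f S] .
    have "good b (restrict_diagram (f ` S) (circles H)) \<longleftrightarrow> good b (restrict_diagram S (circles G))"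
      using good_iso_iff[OF based_diagram_restrict[OF G] based_diagram_restrict[OF H] iso_via_restrict[OF via S ne]] by simp
    moreover have "state_weight H n (f ` S) = state_weight G n S"
      using S sgn by (auto simp: state_weight_def card_image[OF fS] prod.reindex[OF fS] intro!: prod.cong)
    ultimately show "(if good b (restrict_diagram (f ` S) (circles H)) then state_weight H n (f ` S) else 0) =
        (if good b (restrict_diagram S (circles G)) then state_weight G n S else 0)" by simp
  qed
  finally show ?thesis by simp
qed

section \<open>Smoothing\<close>

text \<open>
  Instead of deleting the arrows outside a state, one can keep their endpoints and walk past them.
  Then all states of a diagram are traced on the same set of points.  Each circle \<open>i\<close> gets a
  marker \<open>Inl i\<close> at its cut, so that there is always a starting point and no circle is empty.
\<close>

definition marked :: "diagram \<Rightarrow> (nat + nat endpoint) list list" where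
  "marked C = map (\<lambda>i. Inl i # map Inr (C ! i)) [0..<length C]"

definition points :: "diagram \<Rightarrow> (nat + nat endpoint) set" where
  "points C = set (concat (marked C))"

fun jump :: "nat set \<Rightarrow> nat + nat endpoint \<Rightarrow> nat + nat endpoint" where
  "jump S (Inl i) = Inl i"
| "jump S (Inr p) = Inr (if arrow_of p \<in> S then opposite p else p)"

definition smooth :: "diagram \<Rightarrow> nat set \<Rightarrow> nat + nat endpoint \<Rightarrow> nat + nat endpoint" where
  "smooth C S = cnext (marked C) \<circ> jump S"

fun on_state :: "nat set \<Rightarrow> nat + nat endpoint \<Rightarrow> bool" where
  "on_state S (Inl i) \<longleftrightarrow> False"
| "on_state S (Inr p) \<longleftrightarrow> arrow_of p \<in> S"

text \<open>Covering \<open>points C\<close> includes the markers. A circle without endpoints of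
  \<open>S\<close> closes up on its own marker, so it is allowed only when it is the only
  circle.\<close>

definition smooth_word :: "bool \<Rightarrow> diagram \<Rightarrow> nat set \<Rightarrow> (nat + nat endpoint) list \<Rightarrow> bool" where
  "smooth_word b C S w \<longleftrightarrow> cyclic_word (smooth C S) w \<and> hd w = Inl 0 \<and> set w = points C \<and>
     (\<forall>a\<in>S. before b w (Inr (Head a)) (Inr (Tail a)))"

lemma length_marked[simp]: "length (marked C) = length C"
  by (simp add: marked_def)

lemma nth_marked: "i < length C \<Longrightarrow> marked C ! i = Inl i # map Inr (C ! i)"
  by (simp add: marked_def)

lemma points_eq: "points C = Inl ` {..<length C} \<union> Inr ` endpoints C"
proof -
  have "points C = (\<Union>i<length C. insert (Inl i) (Inr ` set (C ! i)))"
    by (auto simp: points_def marked_def)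
  then show ?thesis by (auto simp: endpoints_nth)
qed

lemma finite_points: "finite (points C)"
  by (simp add: points_def)

lemma distinct_marked:
  assumes "distinct (concat C)"
  shows "distinct (concat (marked C))"
  unfolding distinct_concat_iff
proof (intro conjI ballI allI impI)
  have "distinct (marked C)"
    unfolding marked_def by (auto simp: distinct_map intro: inj_onI)
  then show "distinct (removeAll [] (marked C))" by (rule distinct_removeAll)
next
  fix c assume "c \<in> set (marked C)"
  then show "distinct c"
    using distinct_concat_mem[OF assms] by (auto simp: marked_def distinct_map)
next
  fix c d assume "c \<in> set (marked C) \<and> d \<in> set (marked C) \<and> c \<noteq> d"
  then obtain i j where "i < length C" "j < length C" "c = Inl i # map Inr (C ! i)" "d = Inl j # map Inr (C ! j)" "i \<noteq> j"
    unfolding marked_def by fastforce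
  then show "set c \<inter> set d = {}"
    using nth_concat_unique[OF assms, of i j] by auto
qed

lemma filter_marked: "map (filter (on_state S)) (marked C) = map (map Inr) (restrict_diagram S C)"
  by (rule nth_equalityI)
    (simp_all add: restrict_diagram_def nth_marked restrict_circle_def filter_map comp_def)

lemma jump_points: "based_diagram m C \<Longrightarrow> x \<in> points C \<Longrightarrow> jump S x \<in> points C"
  by (auto simp: points_eq based_diagram_opposite)

lemma jump_jump[simp]: "jump S (jump S x) = x"
  by (cases x) auto

lemma jump_off_state: "\<not> on_state S x \<Longrightarrow> jump S x = x"
  by (cases x) auto

lemma cnext_marked_points: "based_diagram m C \<Longrightarrow> x \<in> points C \<Longrightarrow> cnext (marked C) x \<in> points C"
  unfolding points_def by (intro cnext_closed distinct_marked based_diagram_distinct)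

lemma smooth_points: "based_diagram m C \<Longrightarrow> x \<in> points C \<Longrightarrow> smooth C S x \<in> points C"
  by (simp add: smooth_def cnext_marked_points jump_points)

lemma inj_on_smooth:
  assumes C: "based_diagram m C"
  shows "inj_on (smooth C S) (points C)"
  unfolding smooth_def
proof (rule comp_inj_on)
  show "inj_on (jump S) (points C)" by (rule inj_on_inverseI) (rule jump_jump)
  have "inj_on (cnext (marked C)) (points C)"
    unfolding points_def by (intro inj_on_cnext distinct_marked based_diagram_distinct[OF C])
  then show "inj_on (cnext (marked C)) (jump S ` points C)"
    by (rule inj_on_subset) (auto intro: jump_points[OF C])
qed

text \<open>Between two visits to \<open>P\<close> only points fixed by \<open>j\<close> occur, so
  \<open>j\<close> acts only at the departure from \<open>p\<close>.\<close>

lemma ret_comp: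
  assumes "ret P f y q" "y = j p" "\<And>x. \<not> P x \<Longrightarrow> j x = x"
  shows "ret P (f \<circ> j) p q"
  using assms(1,2)
proof (induction arbitrary: p rule: ret.induct)
  case (now y)
  then show ?case by (subst ret_unfold) simp
next
  case (later y q)
  have "f y = j (f y)" using assms(3)[OF later.hyps(1)] by simp
  then have "ret P (f \<circ> j) (f y) q" by (rule later.IH)
  then show ?case using later.hyps(1) later.prems by (subst ret_unfold) simp
qed

lemma ret_funpow:
  assumes "ret P f p q"
  shows "\<exists>k. P ((f ^^ k) p)"
  using assms
proof (induction rule: ret.induct)
  case (now p)
  then show ?case by (intro exI[of _ 1]) simp
next
  case (later p q)
  then obtain k where "P ((f ^^ k) (f p))" by blast
  then show ?case by (intro exI[of _ "Suc k"]) (simp add: funpow_swap1)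
qed

text \<open>After jumping to the other end of its arrow, the smoothed trace walks past markers and
  arrows outside \<open>S\<close>; erasing these leaves the successor in the subdiagram.\<close>

lemma ret_smooth:
  assumes C: "based_diagram m C" and p: "p \<in> endpoints C" "arrow_of p \<in> S"
  shows "ret (on_state S) (smooth C S) (Inr p) (Inr (trace_step (restrict_diagram S C) p))"
proof -
  have d: "distinct (concat (marked C))" using C by (intro distinct_marked based_diagram_distinct)
  have op: "opposite p \<in> endpoints (restrict_diagram S C)"
    using p based_diagram_opposite[OF C] by (simp add: endpoints_restrict)
  have "cnext (map (filter (on_state S)) (marked C)) (Inr (opposite p)) =
      Inr (cnext (restrict_diagram S C) (opposite p))"
    unfolding filter_marked using op based_diagram_distinct[OF based_diagram_restrict[OF C]]
    by (intro cnext_map) (auto simp: endpoints_def)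
  moreover have "Inr (opposite p) \<in> set (concat (marked C))"
    unfolding points_def[symmetric] points_eq using p based_diagram_opposite[OF C] by blast
  ultimately have "ret (on_state S) (cnext (marked C)) (Inr (opposite p)) (Inr (trace_step (restrict_diagram S C) p))"
    using ret_cnext_filter[OF d, of "Inr (opposite p)" "on_state S"] p(2) by (simp add: trace_step_eq)
  then show ?thesis
    unfolding smooth_def by (rule ret_comp) (use p in \<open>auto simp: jump_off_state\<close>)
qed

lemma ret_smooth_off_state:
  assumes C: "based_diagram m C" and c: "u @ x # v \<in> set (marked C)" "\<exists>y\<in>set (u @ x # v). on_state S y"
    and x: "\<not> on_state S x"
  shows "ret (on_state S) (smooth C S) x (hd (filter (on_state S) (v @ u @ [x])))"
proof -
  have d: "distinct (concat (marked C))" using C by (intro distinct_marked based_diagram_distinct)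
  from ret_cnext[OF d c] show ?thesis
    unfolding smooth_def by (rule ret_comp) (use x in \<open>auto simp: jump_off_state\<close>)
qed

lemma ret_smooth_start:
  assumes C: "based_diagram m C" and ne: "restrict_diagram S C ! 0 \<noteq> []"
  shows "ret (on_state S) (smooth C S) (Inl 0) (Inr (hd (restrict_diagram S C ! 0)))"
proof -
  have C0: "0 < length C" using C by (auto simp: based_diagram_def)
  then have r: "restrict_diagram S C ! 0 = filter (\<lambda>p. arrow_of p \<in> S) (C ! 0)"
    by (simp add: restrict_diagram_def restrict_circle_def)
  have "[] @ Inl 0 # map Inr (C ! 0) \<in> set (marked C)"
    using C0 nth_marked[of 0 C] nth_mem[of 0 "marked C"] by simp
  moreover have "\<exists>y\<in>set ([] @ Inl 0 # map Inr (C ! 0)). on_state S y"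
    using ne by (auto simp: r filter_empty_conv)
  ultimately have "ret (on_state S) (smooth C S) (Inl 0)
      (hd (filter (on_state S) (map Inr (C ! 0) @ [] @ [Inl 0])))"
    by (intro ret_smooth_off_state[OF C]) auto
  also have "filter (on_state S) (map Inr (C ! 0) @ [] @ [Inl 0]) = map Inr (restrict_diagram S C ! 0)"
    by (simp add: r filter_map comp_def)
  also have "hd \<dots> = Inr (hd (restrict_diagram S C ! 0))" using ne by (simp add: hd_map)
  finally show ?thesis .
qed

lemma on_state_points:
  assumes "based_diagram m C"
  shows "{x \<in> points C. on_state S x} = Inr ` endpoints (restrict_diagram S C)"
  by (auto simp: points_eq endpoints_restrict)

text \<open>The boundary word of the subdiagram is a cycle of the first return map and therefore
  lifts. Every point returns to the state because no circle of the subdiagram is empty; the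
  exception \<open>[[]]\<close> is the empty state on one circle, where smoothing just walks
  around.\<close>

lemma good_restrict_imp_smooth_word:
  assumes C: "based_diagram m C" and S: "S \<subseteq> arrows C" and g: "good b (restrict_diagram S C)"
  shows "\<exists>w. smooth_word b C S w"
proof (cases "restrict_diagram S C = [[]]")
  case True
  then have "endpoints (restrict_diagram S C) = {}" by (simp add: endpoints_def)
  then have "arrows (restrict_diagram S C) = {}" by (simp add: arrows_def)
  then have S0: "S = {}" using S by (auto simp: arrows_restrict)
  have "length C = 1" using True by (metis length_map One_nat_def length_Cons list.size(3) restrict_diagram_def)
  then have m: "marked C = [Inl 0 # map Inr (C ! 0)]" by (simp add: marked_def)
  have "jump S x = x" for x using S0 by (cases x) auto
  then have "smooth C S = cnext (marked C)" by (simp add: smooth_def fun_eq_iff)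
  moreover have "distinct (Inl 0 # map Inr (C ! 0) :: (nat + nat endpoint) list)"
    using distinct_marked[OF based_diagram_distinct[OF C]] m by simp
  ultimately have "smooth_word b C S (Inl 0 # map Inr (C ! 0))"
    using S0 m by (simp add: smooth_word_def cyclic_word_def points_def)
  then show ?thesis by blast
next
  case False
  let ?D = "restrict_diagram S C"
  let ?F = "\<lambda>x :: nat + nat endpoint. Inr (trace_step ?D (projr x)) :: nat + nat endpoint"
  from False g obtain v where ne: "[] \<notin> set ?D" and v: "trace_word b ?D v" by (auto simp: good_def)
  have vc: "cyclic_word ?F (map Inr v)"
    using v by (intro cyclic_word_map[where T = "trace_step ?D"]) (auto simp: trace_word_def)
  have vs: "set (map Inr v) = {x \<in> points C. on_state S x}"
    using v on_state_points[OF C] by (simp add: trace_word_def)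
  have start: "Inl 0 \<in> points C" using C by (auto simp: points_eq based_diagram_def)
  have F: "ret (on_state S) (smooth C S) x (?F x)" if "x \<in> points C" "on_state S x" for x
    using that ret_smooth[OF C] by (auto simp: points_eq)
  have reach: "\<exists>k. on_state S ((smooth C S ^^ k) x)" if x: "x \<in> points C" for x
  proof (cases "on_state S x")
    case True
    then show ?thesis by (intro exI[of _ 0]) simp
  next
    case off: False
    from x obtain c where c: "c \<in> set (marked C)" "x \<in> set c" by (auto simp: points_def)
    then obtain u r where ur: "c = u @ x # r" by (meson split_list)
    have "filter (on_state S) c \<in> set (map (filter (on_state S)) (marked C))" using c(1) by simp
    then have "filter (on_state S) c \<noteq> []"
      unfolding filter_marked using ne by auto
    then have "\<exists>y\<in>set (u @ x # r). on_state S y" by (simp add: filter_empty_conv ur[symmetric])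
    from ret_funpow[OF ret_smooth_off_state[OF C c(1)[unfolded ur] this off]] show ?thesis .
  qed
  obtain w where w: "cyclic_word (smooth C S) w" "hd w = Inl 0" "set w = points C"
    using cyclic_word_lift[OF finite_points inj_on_smooth[OF C] smooth_points[OF C] start reach F vc vs] by blast
  have sub: "set (filter (on_state S) w) = set (map Inr v)" unfolding vs using w(3) by auto
  have vne: "v \<noteq> []" using v by (auto simp: trace_word_def cyclic_word_def)
  then have fne: "filter (on_state S) w \<noteq> []" using sub by (metis list.set(1) set_empty map_is_Nil_conv)
  have D0: "?D ! 0 \<in> set ?D" using C by (intro nth_mem) (auto simp: restrict_diagram_def based_diagram_def)
  \<comment> \<open>The lift is only known to pass through the same points. Filtering it gives a
    cycle of the same map with the same head, so the word itself is recovered and the order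
    conditions transfer.\<close>
  have "filter (on_state S) w = map Inr v"
  proof (rule cyclic_word_unique[OF _ vc])
    show "cyclic_word ?F (filter (on_state S) w)"
      using w F by (intro cyclic_word_filter fne) auto
    have "ret (on_state S) (smooth C S) (Inl 0) (hd (filter (on_state S) w))"
      using cyclic_word_filter_hd[OF w(1) fne] w(2) by simp
    moreover have "ret (on_state S) (smooth C S) (Inl 0) (Inr (hd (?D ! 0)))"
      using D0 ne by (intro ret_smooth_start[OF C]) auto
    ultimately have "hd (filter (on_state S) w) = Inr (hd (?D ! 0))" by (rule ret_unique)
    then show "hd (filter (on_state S) w) = hd (map Inr v)"
      using v vne by (simp add: trace_word_def hd_map)
  qed
  moreover have "before b w (Inr (Head a)) (Inr (Tail a))" if a: "a \<in> S" for a
  proof -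
    have "before b v (Head a) (Tail a)" using v a S by (auto simp: trace_word_def arrows_restrict)
    then have "before b (map Inr v) (Inr (Head a)) (Inr (Tail a))" by (subst before_map) auto
    then have "before b (filter (on_state S) w) (Inr (Head a)) (Inr (Tail a))"
      using \<open>filter (on_state S) w = map Inr v\<close> by simp
    then show ?thesis using a by (subst (asm) before_filter) auto
  qed
  ultimately show ?thesis using w by (auto simp: smooth_word_def)
qed

lemma smooth_word_imp_good_restrict:
  assumes C: "based_diagram m C" and S: "S \<subseteq> arrows C" and w: "smooth_word b C S w"
  shows "good b (restrict_diagram S C)"
proof -
  let ?D = "restrict_diagram S C"
  have wc: "cyclic_word (smooth C S) w" "hd w = Inl 0" "set w = points C"
    using w by (auto simp: smooth_word_def)
  have d: "distinct (concat (marked C))" using C by (intro distinct_marked based_diagram_distinct)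
  have lenD: "length ?D = length C" by (simp add: restrict_diagram_def)
  show ?thesis
  proof (cases "[] \<in> set ?D")
    case True
    then obtain i where i: "i < length C" "?D ! i = []" using lenD by (metis in_set_conv_nth)
    let ?c = "marked C ! i"
    have c: "?c \<in> set (marked C)" using i by simp
    have off: "\<not> on_state S x" if "x \<in> set ?c" for x
      using i that by (auto simp: nth_marked restrict_diagram_def restrict_circle_def filter_empty_conv)
    have ic: "Inl i \<in> set ?c" using i by (simp add: nth_marked)
    \<comment> \<open>No jump leaves a circle without endpoints of \<open>S\<close>, so the single
      cycle stays on it; the markers then show that it is the only circle.\<close>
    have "set w \<subseteq> set ?c"
    proof (rule cyclic_word_subset[OF wc(1) _ ic])
      show "Inl i \<in> set w" using wc(3) i by (simp add: points_eq)
      show "smooth C S q \<in> set ?c" if "q \<in> set ?c" for q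
        using that off cnext_mem[OF d c] by (simp add: smooth_def jump_off_state)
    qed
    then have "Inl j \<in> set ?c" if "j < length C" for j
      using that wc(3) by (auto simp: points_eq)
    then have "j = i" if "j < length C" for j using that i by (auto simp: nth_marked)
    then have "length C = 1" using i(1) by (metis One_nat_def Suc_lessI less_Suc0 length_greater_0_conv nat_neq_iff not_less_zero)
    then have "?D = [[]]" using i lenD by (cases ?D) auto
    then show ?thesis by (simp add: good_def)
  next
    case False
    let ?F = "\<lambda>x :: nat + nat endpoint. Inr (trace_step ?D (projr x)) :: nat + nat endpoint"
    let ?v = "map projr (filter (on_state S) w)"
    have D0: "?D ! 0 \<in> set ?D" using C by (intro nth_mem) (auto simp: restrict_diagram_def based_diagram_def)
    have D0': "?D ! 0 \<noteq> []" using D0 False by metis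
    have fs: "set (filter (on_state S) w) = Inr ` endpoints ?D"
      using on_state_points[OF C] wc(3) by auto
    moreover have "hd (?D ! 0) \<in> endpoints ?D"
      unfolding endpoints_def set_concat using D0 D0' hd_in_set by blast
    ultimately have fne: "filter (on_state S) w \<noteq> []" by fastforce
    have F: "ret (on_state S) (smooth C S) x (?F x)" if "x \<in> set w" "on_state S x" for x
      using that wc(3) ret_smooth[OF C] by (auto simp: points_eq)
    have fc: "cyclic_word ?F (filter (on_state S) w)" using wc(1) fne F by (rule cyclic_word_filter)
    have inj: "inj_on projr (set (filter (on_state S) w))" unfolding fs by (auto simp: inj_on_def)
    have "trace_word b ?D ?v"
      unfolding trace_word_def
    proof (intro conjI ballI)
      show "cyclic_word (trace_step ?D) ?v" using fc inj by (rule cyclic_word_map) simp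
      show "set ?v = endpoints ?D" unfolding set_map fs by (simp add: image_image)
      have "ret (on_state S) (smooth C S) (Inl 0) (hd (filter (on_state S) w))"
        using cyclic_word_filter_hd[OF wc(1) fne] wc(2) by simp
      moreover have "ret (on_state S) (smooth C S) (Inl 0) (Inr (hd (?D ! 0)))"
        by (rule ret_smooth_start[OF C D0'])
      ultimately have "hd (filter (on_state S) w) = Inr (hd (?D ! 0))" by (rule ret_unique)
      then show "hd ?v = hd (?D ! 0)" using fne by (simp add: hd_map)
      fix a assume a: "a \<in> arrows ?D"
      then have "before b w (Inr (Head a)) (Inr (Tail a))" using w by (simp add: smooth_word_def arrows_restrict)
      then have "before b (filter (on_state S) w) (Inr (Head a)) (Inr (Tail a))"
        using a by (subst before_filter) (auto simp: arrows_restrict)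
      moreover have "Head a \<in> endpoints ?D" "Tail a \<in> endpoints ?D"
        using a based_diagram_endpoint[OF based_diagram_restrict[OF C]] by auto
      then have "set (filter (on_state S) w) \<union> {Inr (Head a), Inr (Tail a)} = set (filter (on_state S) w)"
        unfolding fs by auto
      then have "before b ?v (projr (Inr (Head a) :: nat + _)) (projr (Inr (Tail a) :: nat + _)) \<longleftrightarrow>
          before b (filter (on_state S) w) (Inr (Head a)) (Inr (Tail a))"
        using inj by (intro before_map) (simp only:)
      ultimately show "before b ?v (Head a) (Tail a)" by simp
    qed
    moreover have "?D \<noteq> []" using D0 by auto
    ultimately show ?thesis using False by (auto simp: good_def)
  qed
qed

lemma good_restrict_iff:
  "based_diagram m C \<Longrightarrow> S \<subseteq> arrows C \<Longrightarrow> good b (restrict_diagram S C) \<longleftrightarrow> (\<exists>w. smooth_word b C S w)"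
  using good_restrict_imp_smooth_word smooth_word_imp_good_restrict by blast

lemma before_total:
  "p \<in> set w \<Longrightarrow> q \<in> set w \<Longrightarrow> p \<noteq> q \<Longrightarrow> before b w p q \<or> before b w q p"
  using prec_total[of p w q] by (auto simp: before_def)

lemma before_trans: "distinct w \<Longrightarrow> before b w p q \<Longrightarrow> before b w q r \<Longrightarrow> before b w p r"
  by (auto simp: before_def intro: prec_trans split: if_splits)

section \<open>The third move\<close>

definition returns :: "('a \<Rightarrow> bool) \<Rightarrow> ('a \<Rightarrow> 'a) \<Rightarrow> 'a \<Rightarrow> bool" where
  "returns P f p \<longleftrightarrow> (\<exists>q. ret P f p q)"

lemma returns_unfold: "returns P f p \<longleftrightarrow> (if P (f p) then True else returns P f (f p))"
  by (auto simp: returns_def ret_unfold[of P f p])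

text \<open>
  The three segments of the move are \<open>a1, a2\<close>, \<open>b1, b2\<close> and \<open>c1, c2\<close>.  The points are thought of
  as positions: they are followed by the same successor map \<open>n\<close> before and after the move, and the
  move only changes which positions are joined by the three arrows, from \<open>jG\<close> to \<open>jH\<close>.
\<close>

locale triangle =
  fixes X :: "'a set" and n j0 :: "'a \<Rightarrow> 'a" and o' a1 a2 b1 b2 c1 c2 :: 'a
    and R :: "'a list \<Rightarrow> bool" and b :: bool
  assumes fin: "finite X" and inj_n: "inj_on n X" and n_closed: "\<And>p. p \<in> X \<Longrightarrow> n p \<in> X"
    and corners: "distinct [o', a1, a2, b1, b2, c1, c2]" "{o', a1, a2, b1, b2, c1, c2} \<subseteq> X"
    and segments: "n a1 = a2" "n b1 = b2" "n c1 = c2"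
    and j0_invol: "\<And>p. j0 (j0 p) = p"
    and j0_closed: "\<And>p. p \<in> X \<Longrightarrow> j0 p \<in> X"
    and j0_corners: "\<And>p. p \<in> {a1, a2, b1, b2, c1, c2} \<Longrightarrow> j0 p = p"
    and R_filter: "\<And>w. R (filter (\<lambda>p. p \<notin> {a2, b2, c2}) w) = R w"
begin

definition jG :: "bool \<Rightarrow> bool \<Rightarrow> bool \<Rightarrow> 'a \<Rightarrow> 'a" where
  "jG x y z p =
     (if p = a1 then (if x then b1 else a1) else if p = b1 then (if x then a1 else b1)
      else if p = a2 then (if y then c1 else a2) else if p = c1 then (if y then a2 else c1)
      else if p = b2 then (if z then c2 else b2) else if p = c2 then (if z then b2 else c2)
      else j0 p)"

text \<open>Reversing the two endpoints on every segment exchanges the indices 1 and 2 throughout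
  the pairs of \<open>jG\<close>.\<close>

definition jH :: "bool \<Rightarrow> bool \<Rightarrow> bool \<Rightarrow> 'a \<Rightarrow> 'a" where
  "jH x y z p =
     (if p = a2 then (if x then b2 else a2) else if p = b2 then (if x then a2 else b2)
      else if p = a1 then (if y then c2 else a1) else if p = c2 then (if y then a1 else c2)
      else if p = b1 then (if z then c1 else b1) else if p = c1 then (if z then b1 else c1)
      else j0 p)"

text \<open>\<open>R\<close> stands for the order conditions of the arrows outside the triangle,
  \<open>\<phi>\<close> for those of the triangle arrows in the state.\<close>

definition state :: "('a \<Rightarrow> 'a) \<Rightarrow> (('a \<Rightarrow> 'a \<Rightarrow> bool) \<Rightarrow> bool) \<Rightarrow> bool" where
  "state j \<phi> \<longleftrightarrow> (\<exists>w. cyclic_word (n \<circ> j) w \<and> hd w = o' \<and> set w = X \<and> R w \<and> \<phi> (before b w))"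

text \<open>
  The first return map to the complement of \<open>{a2, b2, c2}\<close> when the passages entering at \<open>a1\<close>, \<open>b1\<close>
  and \<open>c1\<close> leave the triangle from \<open>e1\<close>, \<open>e2\<close> and \<open>e3\<close>.
\<close>

definition outer :: "'a \<Rightarrow> 'a \<Rightarrow> 'a \<Rightarrow> 'a \<Rightarrow> 'a" where
  "outer e1 e2 e3 p =
     (if p = a1 then n e1 else if p = b1 then n e2 else if p = c1 then n e3 else n (j0 p))"

definition core :: "'a \<Rightarrow> 'a \<Rightarrow> 'a \<Rightarrow> (('a \<Rightarrow> 'a \<Rightarrow> bool) \<Rightarrow> bool) \<Rightarrow> bool" where
  "core e1 e2 e3 \<phi> \<longleftrightarrow> (\<exists>w. cyclic_word (outer e1 e2 e3) w \<and> hd w = o' \<and>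
     set w = X - {a2, b2, c2} \<and> R w \<and> \<phi> (before b w))"

lemma j0_mem: "p \<notin> {a1, a2, b1, b2, c1, c2} \<Longrightarrow> j0 p \<notin> {a1, a2, b1, b2, c1, c2}"
  using j0_corners j0_invol by metis

lemma n_eq:
  assumes "p \<in> X"
  shows "n p = a2 \<longleftrightarrow> p = a1" "n p = b2 \<longleftrightarrow> p = b1" "n p = c2 \<longleftrightarrow> p = c1"
  using assms inj_onD[OF inj_n, of p a1] inj_onD[OF inj_n, of p b1] inj_onD[OF inj_n, of p c1]
    segments corners(2) by auto

text \<open>
  In the premise on the orders, \<open>r\<close> and \<open>s\<close> stand for the order in the boundary word and in its
  restriction: \<open>j a1\<close> is the predecessor of \<open>a2\<close> in the word, so both compare in the same way with
  all other points.
\<close>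

lemma state_eq_core:
  assumes jj: "\<And>p. j (j p) = p" and j_closed: "\<And>p. p \<in> X \<Longrightarrow> j p \<in> X"
    and j_outer: "\<And>p. p \<notin> {a1, a2, b1, b2, c1, c2} \<Longrightarrow> j p = j0 p"
    and r: "ret (\<lambda>p. p \<notin> {a2, b2, c2}) (n \<circ> j) a1 (n e1)"
      "ret (\<lambda>p. p \<notin> {a2, b2, c2}) (n \<circ> j) b1 (n e2)"
      "ret (\<lambda>p. p \<notin> {a2, b2, c2}) (n \<circ> j) c1 (n e3)"
    and exit: "returns (\<lambda>p. p \<notin> {a2, b2, c2}) (n \<circ> j) a2"
      "returns (\<lambda>p. p \<notin> {a2, b2, c2}) (n \<circ> j) b2"
      "returns (\<lambda>p. p \<notin> {a2, b2, c2}) (n \<circ> j) c2"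
    and order: "\<And>r s.
      \<lbrakk>\<And>p. p \<noteq> j a1 \<Longrightarrow> p \<noteq> a2 \<Longrightarrow> r a2 p = r (j a1) p; \<And>p. p \<noteq> j a1 \<Longrightarrow> p \<noteq> a2 \<Longrightarrow> r p a2 = r p (j a1);
       \<And>p. p \<noteq> j b1 \<Longrightarrow> p \<noteq> b2 \<Longrightarrow> r b2 p = r (j b1) p; \<And>p. p \<noteq> j b1 \<Longrightarrow> p \<noteq> b2 \<Longrightarrow> r p b2 = r p (j b1);
       \<And>p. p \<noteq> j c1 \<Longrightarrow> p \<noteq> c2 \<Longrightarrow> r c2 p = r (j c1) p; \<And>p. p \<noteq> j c1 \<Longrightarrow> p \<noteq> c2 \<Longrightarrow> r p c2 = r p (j c1);
       \<And>p q. p \<notin> {a2, b2, c2} \<Longrightarrow> q \<notin> {a2, b2, c2} \<Longrightarrow> s p q = r p q\<rbrakk> \<Longrightarrow> \<phi> r \<longleftrightarrow> \<psi> s"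
  shows "state j \<phi> \<longleftrightarrow> core e1 e2 e3 \<psi>"
proof -
  let ?P = "\<lambda>p. p \<notin> {a2, b2, c2}" and ?T = "n \<circ> j" and ?F = "outer e1 e2 e3"
  have T_closed: "?T p \<in> X" if "p \<in> X" for p using that by (simp add: j_closed n_closed)
  have inj_T: "inj_on ?T X"
  proof (rule comp_inj_on)
    show "inj_on j X" by (rule inj_on_inverseI) (rule jj)
    show "inj_on n (j ` X)" by (rule inj_on_subset[OF inj_n]) (auto intro: j_closed)
  qed
  have F: "ret ?P ?T p (?F p)" if p: "p \<in> X" "?P p" for p
  proof (cases "p \<in> {a1, b1, c1}")
    case True
    then show ?thesis using r corners(1) by (auto simp: outer_def)
  next
    case False
    then have out: "p \<notin> {a1, a2, b1, b2, c1, c2}" using p by auto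
    have "?P (n (j0 p))" using n_eq[OF j0_closed[OF p(1)]] j0_mem[OF out] by auto
    then show ?thesis using False j_outer[OF out] by (subst ret_unfold) (simp add: outer_def)
  qed
  \<comment> \<open>\<open>exit\<close> excludes a cycle confined to \<open>a2\<close>,
    \<open>b2\<close>, \<open>c2\<close>, which \<open>core\<close> could not detect.\<close>
  have reach: "\<exists>k. ?P ((?T ^^ k) p)" if "p \<in> X" for p
  proof (cases "?P p")
    case True
    then show ?thesis by (intro exI[of _ 0]) simp
  next
    case False
    then have "\<exists>q. ret ?P ?T p q" using exit by (auto simp: returns_def)
    then show ?thesis using ret_funpow by metis
  qed
  have o': "o' \<in> X" "?P o'" using corners by auto
  have order': "\<phi> (before b w) \<longleftrightarrow> \<psi> (before b (filter ?P w))"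
    if w: "cyclic_word ?T w" "hd w = o'" "set w = X" for w
  proof (rule order)
    have mem: "j a1 \<in> set w" "j b1 \<in> set w" "j c1 \<in> set w"
      using w(3) j_closed corners(2) by auto
    \<comment> \<open>The start \<open>o'\<close> is none of \<open>a2\<close>, \<open>b2\<close>,
      \<open>c2\<close>, so none of these three successions wraps around.\<close>
    have hd: "?T (j a1) \<noteq> hd w" "?T (j b1) \<noteq> hd w" "?T (j c1) \<noteq> hd w"
      using w(2) corners(1) segments by (auto simp: jj)
    have T: "?T (j a1) = a2" "?T (j b1) = b2" "?T (j c1) = c2" using segments by (auto simp: jj)
    fix p
    show "p \<noteq> j a1 \<Longrightarrow> p \<noteq> a2 \<Longrightarrow> before b w a2 p = before b w (j a1) p"
      and "p \<noteq> j a1 \<Longrightarrow> p \<noteq> a2 \<Longrightarrow> before b w p a2 = before b w p (j a1)"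
      using before_succ[OF w(1) mem(1) hd(1), of p b] unfolding T by auto
    show "p \<noteq> j b1 \<Longrightarrow> p \<noteq> b2 \<Longrightarrow> before b w b2 p = before b w (j b1) p"
      and "p \<noteq> j b1 \<Longrightarrow> p \<noteq> b2 \<Longrightarrow> before b w p b2 = before b w p (j b1)"
      using before_succ[OF w(1) mem(2) hd(2), of p b] unfolding T by auto
    show "p \<noteq> j c1 \<Longrightarrow> p \<noteq> c2 \<Longrightarrow> before b w c2 p = before b w (j c1) p"
      and "p \<noteq> j c1 \<Longrightarrow> p \<noteq> c2 \<Longrightarrow> before b w p c2 = before b w p (j c1)"
      using before_succ[OF w(1) mem(3) hd(3), of p b] unfolding T by auto
  next
    fix p q assume "p \<notin> {a2, b2, c2}" "q \<notin> {a2, b2, c2}"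
    then show "before b (filter ?P w) p q = before b w p q" by (rule before_filter)
  qed
  show ?thesis
  proof
    assume "state j \<phi>"
    then obtain w where w: "cyclic_word ?T w" "hd w = o'" "set w = X" "R w" "\<phi> (before b w)"
      by (auto simp: state_def)
    obtain v where v: "w = o' # v" using w(1,2) by (cases w) (auto simp: cyclic_word_def)
    have ne: "filter ?P w \<noteq> []" and hd: "hd (filter ?P w) = o'" using o' v by auto
    have "cyclic_word ?F (filter ?P w)" using w(1) ne F by (rule cyclic_word_filter) (use w in auto)
    moreover have "set (filter ?P w) = X - {a2, b2, c2}" using w(3) by auto
    ultimately show "core e1 e2 e3 \<psi>"
      using hd w R_filter order'[OF w(1-3)] unfolding core_def by metis
  next
    assume "core e1 e2 e3 \<psi>"
    then obtain v where v: "cyclic_word ?F v" "hd v = o'" "set v = X - {a2, b2, c2}" "R v" "\<psi> (before b v)"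
      by (auto simp: core_def)
    have vs: "set v = {p \<in> X. ?P p}" using v(3) by auto
    obtain w where w: "cyclic_word ?T w" "hd w = o'" "set w = X"
      using cyclic_word_lift[OF fin inj_T T_closed o'(1) reach F v(1) vs] by blast
    obtain u where u: "w = o' # u" using w(1,2) by (cases w) (auto simp: cyclic_word_def)
    have ne: "filter ?P w \<noteq> []" and hd: "hd (filter ?P w) = o'" using o' u by auto
    have "cyclic_word ?F (filter ?P w)" using w(1) ne F by (rule cyclic_word_filter) (use w in auto)
    then have "filter ?P w = v" using v(1) hd v(2) by (intro cyclic_word_unique) auto
    then show "state j \<phi>"
      using w v R_filter order'[OF w] unfolding state_def by metis
  qed
qed

lemma jG_props:
  "jG x y z (jG x y z p) = p" "p \<in> X \<Longrightarrow> jG x y z p \<in> X"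
  "p \<notin> {a1, a2, b1, b2, c1, c2} \<Longrightarrow> jG x y z p = j0 p"
  using corners j0_mem[of p] by (auto simp: jG_def j0_invol j0_closed)

lemma jH_props:
  "jH x y z (jH x y z p) = p" "p \<in> X \<Longrightarrow> jH x y z p \<in> X"
  "p \<notin> {a1, a2, b1, b2, c1, c2} \<Longrightarrow> jH x y z p = j0 p"
  using corners j0_mem[of p] by (auto simp: jH_def j0_invol j0_closed)

lemma n_corner_simps:
  "n a2 \<noteq> a2" "n a2 \<noteq> b2" "n a2 \<noteq> c2" "n b2 \<noteq> a2" "n b2 \<noteq> b2" "n b2 \<noteq> c2"
  "n c2 \<noteq> a2" "n c2 \<noteq> b2" "n c2 \<noteq> c2"
  using n_eq corners by auto

lemma neq:
  "a1 \<noteq> a2" "a1 \<noteq> b1" "a1 \<noteq> b2" "a1 \<noteq> c1" "a1 \<noteq> c2" "a2 \<noteq> b1" "a2 \<noteq> b2" "a2 \<noteq> c1" "a2 \<noteq> c2"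
  "b1 \<noteq> b2" "b1 \<noteq> c1" "b1 \<noteq> c2" "b2 \<noteq> c1" "b2 \<noteq> c2" "c1 \<noteq> c2"
  using corners by auto

lemmas triangle_simps = ret_unfold returns_unfold n_corner_simps segments neq neq[symmetric]

abbreviation "orderG x y z \<equiv> \<lambda>r :: 'a \<Rightarrow> 'a \<Rightarrow> bool. (x \<longrightarrow> r b1 a1) \<and> (y \<longrightarrow> r c1 a2) \<and> (z \<longrightarrow> r c2 b2)"
abbreviation "orderH x y z \<equiv> \<lambda>r :: 'a \<Rightarrow> 'a \<Rightarrow> bool. (x \<longrightarrow> r b2 a2) \<and> (y \<longrightarrow> r c2 a1) \<and> (z \<longrightarrow> r c1 b1)"
abbreviation "stateG x y z \<equiv> state (jG x y z) (orderG x y z)"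
abbreviation "stateH x y z \<equiv> state (jH x y z) (orderH x y z)"

text \<open>Each line follows the three passages. With \<open>x\<close> and \<open>y\<close>
  present, for instance, the passage at \<open>b1\<close> jumps to \<open>a1\<close>, moves to
  \<open>a2\<close>, jumps to \<open>c1\<close>, moves to \<open>c2\<close> and leaves from there.
  Since \<open>b1\<close> is then the predecessor of \<open>a2\<close>, the condition on
  \<open>y\<close> becomes a comparison of \<open>c1\<close> with \<open>b1\<close>.\<close>

lemma states_G:
  "stateG False False False \<longleftrightarrow> core a2 b2 c2 (\<lambda>r. True)"
  "stateG True False False \<longleftrightarrow> core b2 a2 c2 (\<lambda>r. r b1 a1)"
  "stateG False True False \<longleftrightarrow> core c2 b2 a2 (\<lambda>r. r c1 a1)"
  "stateG False False True \<longleftrightarrow> core a2 c2 b2 (\<lambda>r. r c1 b1)"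
  "stateG True True False \<longleftrightarrow> core b2 c2 a2 (\<lambda>r. r b1 a1 \<and> r c1 b1)"
  "stateG True False True \<longleftrightarrow> core c2 a2 b2 (\<lambda>r. r b1 a1 \<and> r c1 a1)"
  "stateG False True True \<longleftrightarrow> core b2 c2 a2 (\<lambda>r. r c1 a1 \<and> r a1 b1)"
  "stateG True True True \<longleftrightarrow> core c2 b2 a2 (\<lambda>r. r b1 a1 \<and> r c1 b1)"
  by (rule state_eq_core[OF jG_props]; simp add: jG_def triangle_simps conj_ac)+

lemma states_H:
  "stateH False False False \<longleftrightarrow> core a2 b2 c2 (\<lambda>r. True)"
  "stateH True False False \<longleftrightarrow> core b2 a2 c2 (\<lambda>r. r b1 a1)"
  "stateH False True False \<longleftrightarrow> core c2 b2 a2 (\<lambda>r. r c1 a1)"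
  "stateH False False True \<longleftrightarrow> core a2 c2 b2 (\<lambda>r. r c1 b1)"
  "stateH True True False \<longleftrightarrow> core c2 a2 b2 (\<lambda>r. r b1 c1 \<and> r c1 a1)"
  "stateH True False True \<longleftrightarrow> core b2 c2 a2 (\<lambda>r. r c1 a1 \<and> r c1 b1)"
  "stateH False True True \<longleftrightarrow> core c2 a2 b2 (\<lambda>r. r b1 a1 \<and> r c1 b1)"
  "stateH True True True \<longleftrightarrow> core c2 b2 a2 (\<lambda>r. r b1 a1 \<and> r c1 b1)"
  by (rule state_eq_core[OF jH_props]; simp add: jH_def triangle_simps conj_ac)+

text \<open>The head determines the word, so \<open>core\<close> evaluates \<open>\<phi>\<close> at
  one fixed order. The last two clauses exclude the two cyclic patterns on \<open>a1\<close>,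
  \<open>b1\<close>, \<open>c1\<close>, leaving the six linear orders for a propositional
  check.\<close>

lemma core_cases:
  obtains "\<And>\<phi>. \<not> core e1 e2 e3 \<phi>"
  | r where "\<And>\<phi>. core e1 e2 e3 \<phi> \<longleftrightarrow> \<phi> r"
    "r a1 b1 \<longleftrightarrow> \<not> r b1 a1" "r a1 c1 \<longleftrightarrow> \<not> r c1 a1" "r b1 c1 \<longleftrightarrow> \<not> r c1 b1"
    "\<not> (r c1 b1 \<and> r b1 a1 \<and> \<not> r c1 a1)" "\<not> (r c1 a1 \<and> \<not> r b1 a1 \<and> \<not> r c1 b1)"
proof (cases "core e1 e2 e3 (\<lambda>r. True)")
  case False
  then have "\<not> core e1 e2 e3 \<phi>" for \<phi> by (auto simp: core_def)
  then show ?thesis using that by blast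
next
  case True
  then obtain w where w: "cyclic_word (outer e1 e2 e3) w" "hd w = o'" "set w = X - {a2, b2, c2}" "R w"
    by (auto simp: core_def)
  have d: "distinct w" using w(1) by (simp add: cyclic_word_def)
  have mem: "a1 \<in> set w" "b1 \<in> set w" "c1 \<in> set w" using corners w(3) by auto
  have "core e1 e2 e3 \<phi> \<longleftrightarrow> \<phi> (before b w)" for \<phi>
  proof
    assume "core e1 e2 e3 \<phi>"
    then obtain v where v: "cyclic_word (outer e1 e2 e3) v" "hd v = o'" "\<phi> (before b v)"
      by (auto simp: core_def)
    then have "v = w" using w by (intro cyclic_word_unique) auto
    then show "\<phi> (before b w)" using v by simp
  qed (use w in \<open>auto simp: core_def\<close>)
  moreover have "before b w p q \<longleftrightarrow> \<not> before b w q p" if "p \<in> set w" "q \<in> set w" "p \<noteq> q" for p q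
    using that before_antisym[OF d] before_total by metis
  note this[OF mem(1,2) neq(2)] this[OF mem(1,3) neq(4)] this[OF mem(2,3) neq(11)]
  moreover have "\<not> (before b w c1 b1 \<and> before b w b1 a1 \<and> \<not> before b w c1 a1)"
    using before_trans[OF d] by blast
  moreover have "\<not> (before b w c1 a1 \<and> before b w a1 b1 \<and> \<not> before b w c1 b1)"
    using before_trans[OF d] by blast
  ultimately show ?thesis by (intro that(2)[of "before b w"]) blast+
qed

lemma exchange1:
  "stateG False False False \<longleftrightarrow> stateH False False False"
  "stateG True False False \<longleftrightarrow> stateH True False False"
  "stateG False True False \<longleftrightarrow> stateH False True False"
  "stateG False False True \<longleftrightarrow> stateH False False True"
  "stateG True True True \<longleftrightarrow> stateH True True True"
  unfolding states_G states_H by (rule refl)+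

lemma exchange2:
  "of_bool (stateG True True False) + of_bool (stateG True False True) + of_bool (stateG False True True) =
   (of_bool (stateH True True False) + of_bool (stateH True False True) + of_bool (stateH False True True) :: int)"
proof -
  \<comment> \<open>These states have exits \<open>b2\<close>, \<open>c2\<close>, \<open>a2\<close>.
    On the right \<open>c1\<close> must precede both \<open>a1\<close> and \<open>b1\<close> in the
    sense of \<open>before b\<close>; the two states on the left split this by the order of
    \<open>a1\<close> and \<open>b1\<close>.\<close>
  have 1: "of_bool (stateG True True False) + of_bool (stateG False True True) = (of_bool (stateH True False True) :: int)"
    unfolding states_G states_H by (rule core_cases[of b2 c2 a2]; simp; blast)
  \<comment> \<open>Here the exits are \<open>c2\<close>, \<open>a2\<close>, \<open>b2\<close>. On
    the left both \<open>b1\<close> and \<open>c1\<close> must precede \<open>a1\<close>; the two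
    states on the right split this by the order of \<open>b1\<close> and \<open>c1\<close>.\<close>
  have 2: "of_bool (stateG True False True) = (of_bool (stateH True True False) + of_bool (stateH False True True) :: int)"
    unfolding states_G states_H by (rule core_cases[of c2 a2 b2]; simp; blast)
  from 1 2 show ?thesis by linarith
qed

end

section \<open>The triangle inside a Gauss diagram\<close>

definition triangle_swap :: "nat \<Rightarrow> nat \<Rightarrow> nat \<Rightarrow> nat endpoint \<Rightarrow> nat endpoint" where
  "triangle_swap x y z = transpose (Tail x) (Tail y) \<circ> transpose (Head x) (Tail z) \<circ> transpose (Head y) (Head z)"

text \<open>The marker stands at the cut, never between two letters that are adjacent in the uncut
  word.\<close>

lemma cnext_marked_adjacent:
  assumes C: "based_diagram m C" and adj: "adjacent C p q"
  shows "cnext (marked C) (Inr p) = Inr q"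
proof -
  from adj obtain i u v where i: "i < length C" "C ! i = u @ [p, q] @ v"
    by (auto simp: adjacent_def sublist_def in_set_conv_nth)
  then have "(Inl i # map Inr u) @ Inr p # (Inr q # map Inr v) \<in> set (marked C)"
    using nth_mem[of i "marked C"] nth_marked[of i C] by simp
  from cnext_split[OF distinct_marked[OF based_diagram_distinct[OF C]] this] show ?thesis by simp
qed

text \<open>\<open>S\<close> is the part of a state outside the triangle; it stays fixed while the
  full state \<open>T\<close> ranges over \<open>S\<close> with any of \<open>x\<close>,
  \<open>y\<close>, \<open>z\<close> added.\<close>

locale triangle_diagram =
  fixes m :: nat and C :: diagram and x y z :: nat and S :: "nat set" and b :: bool
  assumes C: "based_diagram m C" and xyz: "distinct [x, y, z]" "{x, y, z} \<subseteq> arrows C"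
    and adj: "adjacent C (Tail x) (Tail y)" "adjacent C (Head x) (Tail z)" "adjacent C (Head y) (Head z)"
    and S: "S \<subseteq> arrows C - {x, y, z}"
begin

lemma corner_points: "{Inr (Tail x), Inr (Tail y), Inr (Head x), Inr (Tail z), Inr (Head y), Inr (Head z)} \<subseteq> points C"
  using xyz(2) based_diagram_endpoint[OF C] by (auto simp: points_eq)

text \<open>A position is named after the endpoint that occupies it before the move.\<close>

sublocale triangle "points C" "cnext (marked C)" "jump S" "Inl 0" "Inr (Tail x)" "Inr (Tail y)"
  "Inr (Head x)" "Inr (Tail z)" "Inr (Head y)" "Inr (Head z)"
  "\<lambda>w. \<forall>a\<in>S. before b w (Inr (Head a)) (Inr (Tail a))" b
proof
  show "inj_on (cnext (marked C)) (points C)"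
    unfolding points_def by (intro inj_on_cnext distinct_marked based_diagram_distinct[OF C])
  show "distinct [Inl 0, Inr (Tail x), Inr (Tail y), Inr (Head x), Inr (Tail z), Inr (Head y), Inr (Head z)]"
    using xyz(1) by simp
  show "{Inl 0, Inr (Tail x), Inr (Tail y), Inr (Head x), Inr (Tail z), Inr (Head y), Inr (Head z)} \<subseteq> points C"
    using corner_points C by (auto simp: points_eq based_diagram_def)
  show "jump S p = p"
    if "p \<in> {Inr (Tail x), Inr (Tail y), Inr (Head x), Inr (Tail z), Inr (Head y), Inr (Head z)}" for p
    using that S by auto
  show "(\<forall>a\<in>S. before b (filter (\<lambda>p. p \<notin> {Inr (Tail y), Inr (Tail z), Inr (Head z)}) w) (Inr (Head a)) (Inr (Tail a))) =
      (\<forall>a\<in>S. before b w (Inr (Head a)) (Inr (Tail a)))" for w :: "(nat + nat endpoint) list"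
    using S by (intro ball_cong[OF refl] before_filter) auto
qed (use C adj cnext_marked_points jump_points cnext_marked_adjacent in \<open>auto simp: finite_points\<close>)

lemma jump_eq_jG:
  assumes "T - {x, y, z} = S"
  shows "jump T = jG (x \<in> T) (y \<in> T) (z \<in> T)"
proof
  fix p
  have T: "a \<in> T \<longleftrightarrow> a \<in> S" if "a \<noteq> x" "a \<noteq> y" "a \<noteq> z" for a using assms that by blast
  show "jump T p = jG (x \<in> T) (y \<in> T) (z \<in> T) p"
  proof (cases p)
    case (Inr q)
    with T xyz(1) show ?thesis by (cases q) (auto simp: jG_def)
  qed (simp add: jG_def)
qed

lemma good_eq_stateG:
  assumes T: "T \<subseteq> arrows C" "T - {x, y, z} = S"
  shows "good b (restrict_diagram T C) \<longleftrightarrow> stateG (x \<in> T) (y \<in> T) (z \<in> T)"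
proof -
  have "(\<forall>a\<in>T. P a) \<longleftrightarrow> (\<forall>a\<in>S. P a) \<and> (x \<in> T \<longrightarrow> P x) \<and> (y \<in> T \<longrightarrow> P y) \<and> (z \<in> T \<longrightarrow> P z)" for P
    using T(2) by blast
  then show ?thesis
    unfolding good_restrict_iff[OF C T(1)] smooth_word_def smooth_def jump_eq_jG[OF T(2)] state_def by simp
qed

abbreviation "\<tau> \<equiv> triangle_swap x y z"
abbreviation "\<sigma> \<equiv> map_sum id \<tau> :: nat + nat endpoint \<Rightarrow> nat + nat endpoint"

lemma swap_simps:
  "\<tau> (Tail x) = Tail y" "\<tau> (Tail y) = Tail x" "\<tau> (Head x) = Tail z" "\<tau> (Tail z) = Head x"
  "\<tau> (Head y) = Head z" "\<tau> (Head z) = Head y"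
  "a \<notin> {x, y, z} \<Longrightarrow> \<tau> (Tail a) = Tail a" "a \<notin> {x, y, z} \<Longrightarrow> \<tau> (Head a) = Head a"
  using xyz(1) by (auto simp: triangle_swap_def transpose_def)

lemma endpoint_cases:
  obtains "p \<in> {Tail x, Tail y, Head x, Tail z, Head y, Head z}" | a where "p = Tail a" "a \<notin> {x, y, z}"
  | a where "p = Head a" "a \<notin> {x, y, z}"
  by (cases p) auto

lemma swap_swap: "\<tau> (\<tau> p) = p"
  by (rule endpoint_cases[of p]) (auto simp: swap_simps)

lemma swap_endpoints:
  assumes "p \<in> endpoints C"
  shows "\<tau> p \<in> endpoints C"
proof (cases p rule: endpoint_cases)
  case 1
  then show ?thesis
    using xyz(2) by (elim insertE emptyE) (simp_all add: swap_simps based_diagram_endpoint[OF C])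
qed (use assms in \<open>simp_all add: swap_simps\<close>)

lemma endpoints_swap: "endpoints (map (map \<tau>) C) = endpoints C"
proof -
  have "endpoints (map (map \<tau>) C) = \<tau> ` endpoints C" by (auto simp: endpoints_def)
  also have "\<dots> = endpoints C"
  proof
    show "endpoints C \<subseteq> \<tau> ` endpoints C"
      by (rule subsetI, rule image_eqI, rule swap_swap[symmetric], rule swap_endpoints)
  qed (auto intro: swap_endpoints)
  finally show ?thesis .
qed

lemma arrows_swap: "arrows (map (map \<tau>) C) = arrows C"
  by (simp add: arrows_def endpoints_swap)

lemma points_swap: "points (map (map \<tau>) C) = points C"
  by (simp add: points_eq endpoints_swap)

lemma sum_swap_swap: "\<sigma> (\<sigma> p) = p"
  by (cases p) (simp_all add: swap_swap)

lemma sum_swap_points: "p \<in> points C \<Longrightarrow> \<sigma> p \<in> points C"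
  by (auto simp: points_eq swap_endpoints)

lemma marked_swap: "marked (map (map \<tau>) C) = map (map \<sigma>) (marked C)"
  by (simp add: marked_def)

text \<open>After the move the endpoint \<open>p\<close> stands at position
  \<open>\<sigma> p\<close>, so joining the ends of each arrow turns into \<open>jH\<close> on
  positions.\<close>

lemma jH_eq_jump:
  assumes "T - {x, y, z} = S"
  shows "jH (x \<in> T) (y \<in> T) (z \<in> T) (\<sigma> p) = \<sigma> (jump T p)"
proof (cases p)
  case (Inr q)
  have T: "a \<in> T \<longleftrightarrow> a \<in> S" if "a \<noteq> x" "a \<noteq> y" "a \<noteq> z" for a using assms that by blast
  have "jH (x \<in> T) (y \<in> T) (z \<in> T) (\<sigma> (Inr q)) = \<sigma> (jump T (Inr q))"
  proof (cases q rule: endpoint_cases)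
    case 1
    then show ?thesis using xyz(1) by (elim insertE emptyE) (simp_all add: jH_def swap_simps)
  qed (use T in \<open>simp_all add: jH_def swap_simps\<close>)
  then show ?thesis by (simp only: Inr)
qed (simp add: jH_def)

text \<open>Translating endpoints into positions by the involution \<open>\<sigma>\<close>
  conjugates the smoothed trace of the moved diagram to \<open>jH\<close> followed by the successor
  map of the original one. Boundary words then correspond letter by letter, and the marker of the
  base point is fixed.\<close>

lemma good_eq_stateH:
  assumes C': "based_diagram m (map (map \<tau>) C)" and T: "T \<subseteq> arrows C" "T - {x, y, z} = S"
  shows "good b (restrict_diagram T (map (map \<tau>) C)) \<longleftrightarrow> stateH (x \<in> T) (y \<in> T) (z \<in> T)"
proof -
  let ?j = "jH (x \<in> T) (y \<in> T) (z \<in> T)" and ?C = "map (map \<tau>) C"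
  let ?U = "cnext (marked C) \<circ> ?j"
  have step: "?U (\<sigma> p) = \<sigma> (smooth ?C T p)" if p: "p \<in> points C" for p
  proof -
    define q where "q = \<sigma> (jump T p)"
    have q: "q \<in> points C" unfolding q_def using jump_points[OF C p] by (rule sum_swap_points)
    have "smooth ?C T p = cnext (map (map \<sigma>) (marked C)) (\<sigma> q)"
      by (simp add: smooth_def marked_swap q_def sum_swap_swap)
    also have "\<dots> = \<sigma> (cnext (marked C) q)"
    proof (rule cnext_map)
      show "distinct (concat (marked C))" using C by (intro distinct_marked based_diagram_distinct)
      show "inj_on \<sigma> (set (concat (marked C)))" by (rule inj_on_inverseI) (rule sum_swap_swap)
    qed (use q in \<open>simp only: points_def\<close>)
    finally show ?thesis
      by (simp add: jH_eq_jump[OF T(2)] sum_swap_swap q_def)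
  qed
  have step': "smooth ?C T (\<sigma> p) = \<sigma> (?U p)" if p: "p \<in> points C" for p
    using step[OF sum_swap_points[OF p]] by (metis sum_swap_swap)
  have inj: "inj_on \<sigma> A" for A by (rule inj_on_inverseI) (rule sum_swap_swap)
  have img: "\<sigma> ` points C = points C"
  proof
    show "points C \<subseteq> \<sigma> ` points C"
      by (rule subsetI, rule image_eqI, rule sum_swap_swap[symmetric], rule sum_swap_points)
    show "\<sigma> ` points C \<subseteq> points C" by (rule image_subsetI) (rule sum_swap_points)
  qed
  have hd0: "hd (map \<sigma> w) = Inl 0" if "hd w = Inl 0" "w \<noteq> []" for w using that by (simp add: hd_map)
  have bm: "before b (map \<sigma> w) (\<sigma> p) (\<sigma> q) \<longleftrightarrow> before b w p q" for w p q by (rule before_map) (rule inj)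
  have split: "(\<forall>a\<in>T. P a) \<longleftrightarrow> (\<forall>a\<in>S. P a) \<and> (x \<in> T \<longrightarrow> P x) \<and> (y \<in> T \<longrightarrow> P y) \<and> (z \<in> T \<longrightarrow> P z)" for P
    using T(2) by blast
  have order: "(\<forall>a\<in>T. before b w (Inr (Head a)) (Inr (Tail a))) \<longleftrightarrow>
      (\<forall>a\<in>S. before b (map \<sigma> w) (Inr (Head a)) (Inr (Tail a))) \<and>
      orderH (x \<in> T) (y \<in> T) (z \<in> T) (before b (map \<sigma> w))" for w
  proof -
    have "(\<forall>a\<in>S. before b w (Inr (Head a)) (Inr (Tail a))) \<longleftrightarrow>
        (\<forall>a\<in>S. before b (map \<sigma> w) (Inr (Head a)) (Inr (Tail a)))"
    proof (rule ball_cong[OF refl])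
      fix a assume "a \<in> S"
      then have "a \<notin> {x, y, z}" using S by auto
      then show "before b w (Inr (Head a)) (Inr (Tail a)) = before b (map \<sigma> w) (Inr (Head a)) (Inr (Tail a))"
        using bm[of w "Inr (Head a)" "Inr (Tail a)"] by (simp add: swap_simps)
    qed
    then show ?thesis
      unfolding split using bm[of w "Inr (Head x)" "Inr (Tail x)"] bm[of w "Inr (Head y)" "Inr (Tail y)"]
        bm[of w "Inr (Head z)" "Inr (Tail z)"] by (simp add: swap_simps)
  qed
  have T': "T \<subseteq> arrows ?C" using T(1) by (simp only: arrows_swap)
  show ?thesis
    unfolding good_restrict_iff[OF C' T']
  proof
    assume "\<exists>w. smooth_word b ?C T w"
    then obtain w where w: "cyclic_word (smooth ?C T) w" "hd w = Inl 0" "set w = points C"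
      "\<forall>a\<in>T. before b w (Inr (Head a)) (Inr (Tail a))"
      by (auto simp: smooth_word_def points_swap)
    have "cyclic_word ?U (map \<sigma> w)" using w(1) inj by (rule cyclic_word_map) (use step w(3) in simp)
    moreover have "w \<noteq> []" using w(1) by (simp add: cyclic_word_def)
    ultimately show "stateH (x \<in> T) (y \<in> T) (z \<in> T)"
      unfolding state_def using hd0[OF w(2)] w(3,4) order[of w] img by (intro exI[of _ "map \<sigma> w"]) simp
  next
    assume "stateH (x \<in> T) (y \<in> T) (z \<in> T)"
    then obtain v where v: "cyclic_word ?U v" "hd v = Inl 0" "set v = points C"
      "\<forall>a\<in>S. before b v (Inr (Head a)) (Inr (Tail a))" "orderH (x \<in> T) (y \<in> T) (z \<in> T) (before b v)"
      unfolding state_def by blast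
    have vv: "map \<sigma> (map \<sigma> v) = v" by (simp add: comp_def sum_swap_swap)
    have "cyclic_word (smooth ?C T) (map \<sigma> v)" using v(1) inj by (rule cyclic_word_map) (use step' v(3) in simp)
    moreover have "v \<noteq> []" using v(1) by (simp add: cyclic_word_def)
    moreover have "\<forall>a\<in>T. before b (map \<sigma> v) (Inr (Head a)) (Inr (Tail a))"
      unfolding order vv using v(4,5) by blast
    ultimately show "\<exists>w. smooth_word b ?C T w"
      unfolding smooth_word_def points_swap using hd0[OF v(2)] v(3) img by (intro exI[of _ "map \<sigma> v"]) simp
  qed
qed

end

section \<open>Invariance of the state sum\<close>

lemma state_sum_omega3:
  assumes G: "based_diagram m (circles G)" and H: "based_diagram m (circles H)" and "omega3 G H"
  shows "state_sum b n G = state_sum b n H"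
proof -
  let ?C = "circles G"
  from \<open>omega3 G H\<close> obtain x y z where xyz: "distinct [x, y, z]" "{x, y, z} \<subseteq> arrows ?C"
    and sgn: "sign G x = 1" "sign G y = 1" "sign G z = 1"
    and adj: "adjacent ?C (Tail x) (Tail y)" "adjacent ?C (Head x) (Tail z)" "adjacent ?C (Head y) (Head z)"
    and H_eq: "H = Gauss (map (map (triangle_swap x y z)) ?C) (sign G)"
    unfolding omega3_def triangle_swap_def by blast
  let ?D = "map (map (triangle_swap x y z)) ?C"
  define A where "A = arrows ?C - {x, y, z}"
  have D: "based_diagram m ?D" using H by (simp add: H_eq)
  have A: "arrows ?C = insert x (insert y (insert z A))" using xyz by (auto simp: A_def)
  have fin: "finite A" "x \<notin> A" "y \<notin> A" "z \<notin> A" by (simp_all add: finite_arrows A_def)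
  define F where "F E T = (if good b (restrict_diagram T E) then state_weight G n T else 0)" for E T
  have expand: "sum (F E) (Pow (arrows ?C)) = (\<Sum>S\<in>Pow A.
      F E S + F E (insert z S) + F E (insert y S) + F E (insert y (insert z S)) +
      (F E (insert x S) + F E (insert x (insert z S)) + F E (insert x (insert y S)) +
       F E (insert x (insert y (insert z S)))))" for E
    unfolding A using fin xyz(1) by (simp add: sum_Pow_insert sum.distrib add_ac)
  have "arrows ?D = arrows ?C"
  proof -
    \<comment> \<open>The equality of the arrow sets involves no state, so the empty outer part
      suffices.\<close>
    interpret triangle_diagram m ?C x y z "{}" b using G xyz adj by unfold_locales auto
    show ?thesis by (rule arrows_swap)
  qed
  moreover have "state_weight (Gauss ?D (sign G)) = state_weight G"
    by (simp add: state_weight_def fun_eq_iff)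
  ultimately have "state_sum b n H = sum (F ?D) (Pow (arrows ?C))"
    by (simp add: state_sum_def H_eq F_def cong: if_cong)
  moreover have "state_sum b n G = sum (F ?C) (Pow (arrows ?C))"
    by (simp add: state_sum_def F_def)
  moreover have "sum (F ?C) (Pow (arrows ?C)) = sum (F ?D) (Pow (arrows ?C))"
    unfolding expand
  proof (rule sum.cong[OF refl])
    fix S assume "S \<in> Pow A"
    then have S: "S \<subseteq> arrows ?C - {x, y, z}" by (simp add: A_def)
    then have notin: "x \<notin> S" "y \<notin> S" "z \<notin> S" and fS: "finite S" using finite_subset[OF S] finite_arrows[of ?C] by auto
    interpret triangle_diagram m ?C x y z S b using G xyz adj S by unfold_locales auto
    \<comment> \<open>All three triangle arrows are positive, so the weight depends only on how many
      of them, \<open>k\<close>, the state contains. This allows the states with two triangle arrows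
      to be exchanged among each other.\<close>
    define v where "v k = (if card S + k = n then \<Prod>a\<in>S. sign G a else 0)" for k
    have F: "F ?C T = of_bool (stateG fx fy fz) * v k" "F ?D T = of_bool (stateH fx fy fz) * v k"
      if "T - {x, y, z} = S" "(x \<in> T) = fx" "(y \<in> T) = fy" "(z \<in> T) = fz" "state_weight G n T = v k"
      for T fx fy fz k
    proof -
      have "T \<subseteq> arrows ?C" using that(1) xyz(2) S by blast
      then show "F ?C T = of_bool (stateG fx fy fz) * v k" "F ?D T = of_bool (stateH fx fy fz) * v k"
        using good_eq_stateG[OF _ that(1)] good_eq_stateH[OF D _ that(1)]
        unfolding F_def that(2-5) by simp_all
    qed
    have FG:
      "F ?C S = of_bool (stateG False False False) * v 0"
      "F ?C (insert x S) = of_bool (stateG True False False) * v 1"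
      "F ?C (insert y S) = of_bool (stateG False True False) * v 1"
      "F ?C (insert z S) = of_bool (stateG False False True) * v 1"
      "F ?C (insert x (insert y S)) = of_bool (stateG True True False) * v 2"
      "F ?C (insert x (insert z S)) = of_bool (stateG True False True) * v 2"
      "F ?C (insert y (insert z S)) = of_bool (stateG False True True) * v 2"
      "F ?C (insert x (insert y (insert z S))) = of_bool (stateG True True True) * v 3"
      by (rule F; use xyz(1) notin fS sgn in \<open>auto simp: state_weight_def v_def\<close>)+
    have FH:
      "F ?D S = of_bool (stateH False False False) * v 0"
      "F ?D (insert x S) = of_bool (stateH True False False) * v 1"
      "F ?D (insert y S) = of_bool (stateH False True False) * v 1"
      "F ?D (insert z S) = of_bool (stateH False False True) * v 1"
      "F ?D (insert x (insert y S)) = of_bool (stateH True True False) * v 2"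
      "F ?D (insert x (insert z S)) = of_bool (stateH True False True) * v 2"
      "F ?D (insert y (insert z S)) = of_bool (stateH False True True) * v 2"
      "F ?D (insert x (insert y (insert z S))) = of_bool (stateH True True True) * v 3"
      by (rule F; use xyz(1) notin fS sgn in \<open>auto simp: state_weight_def v_def\<close>)+
    have e2: "of_bool (stateG True True False) * v 2 + of_bool (stateG True False True) * v 2 + of_bool (stateG False True True) * v 2 =
      of_bool (stateH True True False) * v 2 + of_bool (stateH True False True) * v 2 + of_bool (stateH False True True) * v 2"
      using arg_cong[OF exchange2, of "\<lambda>t. t * v 2"] unfolding distrib_right .
    show "F ?C S + F ?C (insert z S) + F ?C (insert y S) + F ?C (insert y (insert z S)) +
      (F ?C (insert x S) + F ?C (insert x (insert z S)) + F ?C (insert x (insert y S)) +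
       F ?C (insert x (insert y (insert z S)))) =
      F ?D S + F ?D (insert z S) + F ?D (insert y S) + F ?D (insert y (insert z S)) +
      (F ?D (insert x S) + F ?D (insert x (insert z S)) + F ?D (insert x (insert y S)) +
       F ?D (insert x (insert y (insert z S))))"
      unfolding FG FH exchange1 using e2 by linarith
  qed
  ultimately show ?thesis by simp
qed

lemma state_sum_reidemeister_step:
  assumes "reidemeister_step m G H"
  shows "state_sum b n G = state_sum b n H"
proof -
  have G: "based_diagram m (circles G)" and H: "based_diagram m (circles H)"
    and step: "gauss_iso G H \<or> omega1 G H \<or> omega2 G H \<or> omega3 G H"
    using assms by (auto simp: reidemeister_step_def based_gauss_diagram_def)
  from step show ?thesis
    using state_sum_gauss_iso[OF G H] state_sum_omega1[OF H] state_sum_omega2[OF H] state_sum_omega3[OF G H]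
    by blast
qed

theorem theorem3p2:
  fixes m :: nat and L :: "gauss_diagram set" and G H :: gauss_diagram
  assumes "m \<ge> 1"
    and "L \<in> long_links m"
    and "G \<in> L" and "H \<in> L"
  shows "nabla_asc G = nabla_asc H \<and> nabla_des G = nabla_des H"
proof -
  have invariant: "state_sum b n K = state_sum b n M" if "(K, M) \<in> long_link_rel m" for K M b n
  proof -
    have "equivclp (reidemeister_step m) K M" using that by (simp add: long_link_rel_def)
    then show ?thesis
      by (induction rule: equivclp_induct) (use state_sum_reidemeister_step in metis)+
  qed
  \<comment> \<open>Both diagrams are compared with a common representative \<open>K\<close> of the
    class.\<close>
  obtain K where K: "L = long_link_rel m `` {K}" using assms(2) unfolding long_links_def by (rule quotientE)
  then have KG: "(K, G) \<in> long_link_rel m" and KH: "(K, H) \<in> long_link_rel m"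
    using assms(3,4) by auto
  show ?thesis
  proof (rule nabla_eqI)
    show "based_gauss_diagram m G" "based_gauss_diagram m H"
      using KG KH by (auto simp: long_link_rel_def)
    show "state_sum b n G = state_sum b n H" for b n
      using invariant[OF KG] invariant[OF KH] by metis
  qed
qed

end
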